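(* Let $v\in\Theta^0_0+\mathscr{E}$ have nonzero quadratic part, i.e. the coefficient of $E^1_1$ in $v$ is nonzero. There exists a natural number $r\ge2$ such that $v$ can be transformed into the simplest orbital normal form $$v^{(\infty)}=\Theta^0_0+E^1_1+\beta^0_1E^0_1+\beta^0_rE^0_r$$ for some $\beta^0_1,\beta^0_r\in\mathbb{F}$. Furthermore, the symmetry group of the vector field $v^{(\infty)}$ is not finitely generated. When $\beta^0_r\ne0$, the symmetry group has no non-trivial symmetry from the group of permissible changes of state variables.
   Context: $\mathbb{F}$ is a field of characteristic zero. Let $E:=x\frac{\partial}{\partial x}+\frac12 y\frac{\partial}{\partial y}+\frac12 z\frac{\partial}{\partial z}$, $E^l_k:=x^l(y^2+z^2)^{k-l}E$ for $0\le l\le k$, and $\Theta^0_0:=z\frac{\partial}{\partial y}-y\frac{\partial}{\partial z}$. Let $\mathscr{E}$ be the Lie algebra of all formal sums $\sum\beta^l_kE^l_k$ ($\beta^l_k\in\mathbb{F}$, $k\ge l\ge0$, $l+k\ge1$). One has $[E^l_k,E^m_n]=(n-k)E^{l+m}_{k+n}$ and $[E^l_k,\Theta^0_0]=0$. Time rescaling: let $Z^m_n:=x^m(y^2+z^2)^{n-m}$ for $0\le m\le n$, and let $\mathscr{R}$ be the space of formal sums $\sum a^m_nZ^m_n$ with $n\ge m\ge0$, $n\neq0$. $\mathscr{R}$ acts on $\mathscr{E}$ by multiplication, $Z^m_nE^l_k=E^{m+l}_{n+k}$. Grading: $\delta(E^l_k)=\delta(Z^l_k):=2k-l$, with homogeneous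 parts $\mathscr{E}_i,\mathscr{R}_i$. Let $A_i:=\mathscr{E}_i\times\mathscr{R}_i$ and $A:=\sum_{i\ge1}A_i$, with action $(S,T)*u:=[S,u]+Tu$ for $(S,T)\in A$, $u\in\mathscr{E}$. Transformations: the linear part $\Theta^0_0$ is first removed from $v$ by the time-dependent rotation of the $(y,z)$-variables given by its flow (which replaces $v=\Theta^0_0+u$ by $u\in\mathscr{E}$). Then $u$ is transformed by permissible transformations, namely near-identity formal changes of state variables generated by $S\in\sum_{i\ge1}\mathscr{E}_i$ (acting by $\exp(\mathrm{ad}_S)$) and near-identity formal time rescalings $u\mapsto(1+T)u$, $T\in\mathscr{R}$, together with a constant rescaling used to make the coefficient of $E^1_1$ equal to $1$. Finally $\Theta^0_0$ is put back by the inverse rotation. Levels: for $u=\sum_{i\ge1}u_i\in\mathscr{E}$ (grade decomposition, $u_0:=0$), define inductively $d^{n,1}(Y_n):=Y_n*u_0$ for $Y_n\in A_n$, and for $2\le k\le n$, $d^{n,k}(Y_n,Y_{n-1},\ldots,Y_{n-k+1}):=\sum_{i=0}^{k-1}Y_{n-i}*u_i$ on $A_n\times\ker(d^{n-1,k-1})$, where $(Y_{n-1},\ldots,Y_{n-k+1})\in\ker(d^{n-1,k-1})$. A normal form style fixes a complement $\mathcal{C}^{n,k}$ of $\operatorname{im}d^{n,k}$ in $\mathscr{E}_n$. $\Theta^0_0+u$ is in simplest (= infinite level) orbital normal form if $u_n\in\mathcal{C}^{n,n}$ for every $n\in\mathbb{N}$, for such a choice of complements. Symmetry group: with $u=v^{(\infty)}-\Theta^0_0$,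 the symmetry group of $v^{(\infty)}$ is the group of permissible transformations leaving $u$ invariant (composed with the rotation removing $\Theta^0_0$ and its inverse). It is generated by $B:=\{(S,T)\in A:(S,T)*u=0\}$. Symmetries from the group of permissible changes of state variables are those generated by elements $(S,0)\in B$. Such a symmetry is trivial if $S$ is a scalar multiple of $u$. *)

theory Defs
  imports
    "HOL-Analysis.Cartesian_Space"
    "HOL-Computational_Algebra.Formal_Power_Series"
    "HOL-Library.Groups_Big_Fun"
    "HOL-Algebra.Bij"
    "HOL-Algebra.Generated_Groups"
begin

section \<open>Formal power series and formal vector fields in x, y, z\<close>

text \<open>The ring F[[x,y,z]] is represented as F[[x]][[y]][[z]]: the innermost variable is x and
  the outermost one is z.\<close>

type_synonym 'a ps = "'a fps fps fps"

definition ps_coeff :: "'a ps \<Rightarrow> nat \<Rightarrow> nat \<Rightarrow> nat \<Rightarrow> 'a" where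
  \<comment> \<open>coefficient of the monomial with exponents a, b, c in x, y, z\<close>
  "ps_coeff f a b c = fps_nth (fps_nth (fps_nth f c) b) a"

definition ps_const :: "'a::field_char_0 \<Rightarrow> 'a ps" where
  "ps_const c = fps_const (fps_const (fps_const c))"

definition var_x :: "'a::field_char_0 ps" where "var_x = fps_const (fps_const fps_X)"
definition var_y :: "'a::field_char_0 ps" where "var_y = fps_const fps_X"
definition var_z :: "'a::field_char_0 ps" where "var_z = fps_X"

definition d_x :: "'a::field_char_0 ps \<Rightarrow> 'a ps" where
  "d_x f = Abs_fps (\<lambda>c. Abs_fps (\<lambda>b. fps_deriv (fps_nth (fps_nth f c) b)))"
definition d_y :: "'a::field_char_0 ps \<Rightarrow> 'a ps" where
  "d_y f = Abs_fps (\<lambda>c. fps_deriv (fps_nth f c))"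
definition d_z :: "'a::field_char_0 ps \<Rightarrow> 'a ps" where
  "d_z f = fps_deriv f"

text \<open>Formal (possibly infinite) sums are taken coefficientwise. Every formal sum used below is
  locally finite, i.e. only finitely many summands contribute to a given coefficient; the default
  value of \<^const>\<open>Sum_any\<close> for infinite supports is never used.\<close>

definition ps_sum :: "('i \<Rightarrow> 'a::field_char_0 ps) \<Rightarrow> 'a ps" where
  "ps_sum F = Abs_fps (\<lambda>c. Abs_fps (\<lambda>b. Abs_fps (\<lambda>a. Sum_any (\<lambda>i. ps_coeff (F i) a b c))))"

text \<open>The components 1, 2, 3 of a vector field are its coefficients at the partial derivatives with
  respect to x, y, z. The operation \<open>f *s X\<close> multiplies a vector field by a power series.\<close>

type_synonym 'a vf = "'a ps ^ 3"

definition vf_scale :: "'a::field_char_0 \<Rightarrow> 'a vf \<Rightarrow> 'a vf" where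
  "vf_scale c X = ps_const c *s X"

definition vf_sum :: "('i \<Rightarrow> 'a::field_char_0 vf) \<Rightarrow> 'a vf" where
  "vf_sum F = (\<chi> j. ps_sum (\<lambda>i. F i $ j))"

definition vf_apply :: "'a::field_char_0 vf \<Rightarrow> 'a ps \<Rightarrow> 'a ps" where
  "vf_apply X f = X $ 1 * d_x f + X $ 2 * d_y f + X $ 3 * d_z f"

definition lie :: "'a::field_char_0 vf \<Rightarrow> 'a vf \<Rightarrow> 'a vf" where
  "lie X Y = (\<chi> j. vf_apply X (Y $ j) - vf_apply Y (X $ j))"

interpretation vf: vector_space "vf_scale :: 'a::field_char_0 \<Rightarrow> 'a vf \<Rightarrow> 'a vf"
proof
  fix a b :: 'a and X Y :: "'a vf"
  have mult: "ps_const (a * b) = ps_const a * ps_const b"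
    and add: "ps_const (a + b) = ps_const a + ps_const b"
    and one: "ps_const (1::'a) = 1"
    by (simp_all add: ps_const_def)
  show "vf_scale a (X + Y) = vf_scale a X + vf_scale a Y"
    by (simp add: vf_scale_def vec_eq_iff algebra_simps)
  show "vf_scale (a + b) X = vf_scale a X + vf_scale b X"
    by (simp add: vf_scale_def vec_eq_iff add algebra_simps)
  show "vf_scale a (vf_scale b X) = vf_scale (a * b) X"
    by (simp add: vf_scale_def vec_eq_iff mult algebra_simps)
  show "vf_scale 1 X = X"
    by (simp add: vf_scale_def vec_eq_iff one)
qed

section \<open>The Lie algebra and the time rescaling space\<close>

definition Eul :: "'a::field_char_0 vf" where
  "Eul = vector [var_x, ps_const (1/2) * var_y, ps_const (1/2) * var_z]"

definition Theta :: "'a::field_char_0 vf" where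
  "Theta = vector [0, var_z, - var_y]"

definition Zmon :: "nat \<Rightarrow> nat \<Rightarrow> 'a::field_char_0 ps" where
  \<comment> \<open>first argument: upper index, second argument: lower index\<close>
  "Zmon m n = var_x ^ m * (var_y ^ 2 + var_z ^ 2) ^ (n - m)"

definition Emon :: "nat \<Rightarrow> nat \<Rightarrow> 'a::field_char_0 vf" where
  \<comment> \<open>first argument: upper index, second argument: lower index\<close>
  "Emon l k = Zmon l k *s Eul"

definition E_coeffs :: "(nat \<Rightarrow> nat \<Rightarrow> 'a::field_char_0) set" where
  "E_coeffs = {\<beta>. \<forall>l k. \<beta> l k \<noteq> 0 \<longrightarrow> l \<le> k \<and> 1 \<le> l + k}"

definition E_series :: "(nat \<Rightarrow> nat \<Rightarrow> 'a::field_char_0) \<Rightarrow> 'a vf" where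
  "E_series \<beta> = vf_sum (\<lambda>(l, k). vf_scale (\<beta> l k) (Emon l k))"

definition E_alg :: "'a::field_char_0 vf set" where
  "E_alg = E_series ` E_coeffs"

definition R_coeffs :: "(nat \<Rightarrow> nat \<Rightarrow> 'a::field_char_0) set" where
  "R_coeffs = {a. \<forall>m n. a m n \<noteq> 0 \<longrightarrow> m \<le> n \<and> n \<noteq> 0}"

definition R_series :: "(nat \<Rightarrow> nat \<Rightarrow> 'a::field_char_0) \<Rightarrow> 'a ps" where
  "R_series a = ps_sum (\<lambda>(m, n). ps_const (a m n) * Zmon m n)"

definition R_space :: "'a::field_char_0 ps set" where
  "R_space = R_series ` R_coeffs"

definition grade :: "nat \<Rightarrow> nat \<Rightarrow> nat" where
  "grade l k = 2 * k - l"

definition E_hom :: "nat \<Rightarrow> 'a::field_char_0 vf set" where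
  "E_hom i = E_series ` {\<beta> \<in> E_coeffs. \<forall>l k. \<beta> l k \<noteq> 0 \<longrightarrow> grade l k = i}"

definition R_hom :: "nat \<Rightarrow> 'a::field_char_0 ps set" where
  "R_hom i = R_series ` {a \<in> R_coeffs. \<forall>m n. a m n \<noteq> 0 \<longrightarrow> grade m n = i}"

definition A_hom :: "nat \<Rightarrow> ('a::field_char_0 vf \<times> 'a ps) set" where
  "A_hom i = E_hom i \<times> R_hom i"

text \<open>All grades occurring in \<^const>\<open>E_alg\<close> and \<^const>\<open>R_space\<close> are at least 1, so the formal sums
  of homogeneous elements of grades \<open>i \<ge> 1\<close> make up the whole spaces.\<close>

definition A_space :: "('a::field_char_0 vf \<times> 'a ps) set" where
  "A_space = E_alg \<times> R_space"

definition act :: "'a::field_char_0 vf \<times> 'a ps \<Rightarrow> 'a vf \<Rightarrow> 'a vf" where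
  "act Y u = lie (fst Y) u + snd Y *s u"

definition E_coeff_of :: "'a::field_char_0 vf \<Rightarrow> nat \<Rightarrow> nat \<Rightarrow> 'a" where
  "E_coeff_of u = inv_into E_coeffs E_series u"

definition hpart :: "'a::field_char_0 vf \<Rightarrow> nat \<Rightarrow> 'a vf" where
  "hpart u i = E_series (\<lambda>l k. if grade l k = i then E_coeff_of u l k else 0)"

section \<open>Removing and restoring the linear part by the rotation\<close>

text \<open>A formal power series in the time t whose coefficients are vector fields is a time-dependent
  vector field; \<^const>\<open>fps_const\<close> embeds the autonomous ones. If \<open>\<phi>\<^sub>t\<close> is the flow of
  \<open>\<Theta>\<close> (the rotation of the (y,z)-plane), the pullback of \<open>w\<close> along \<open>\<phi>\<close> at time \<open>s t\<close> is
  \<open>exp (s t ad\<^sub>\<Theta>) w\<close>. The substitution \<open>p = \<phi>\<^sub>t q\<close> turns the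
  system \<open>p' = w(t, p)\<close> into \<open>q' = (exp (t ad\<^sub>\<Theta>) w - \<Theta>)(t, q)\<close>.\<close>

definition flow_pullback :: "'a::field_char_0 \<Rightarrow> 'a vf fps \<Rightarrow> 'a vf fps" where
  "flow_pullback s w =
     Abs_fps (\<lambda>n. \<Sum>j\<le>n. vf_scale (s ^ j / fact j) ((lie Theta ^^ j) (fps_nth w (n - j))))"

definition to_rotating_frame :: "'a::field_char_0 vf fps \<Rightarrow> 'a vf fps" where
  "to_rotating_frame w = flow_pullback 1 w - fps_const Theta"

definition from_rotating_frame :: "'a::field_char_0 vf fps \<Rightarrow> 'a vf fps" where
  "from_rotating_frame w = flow_pullback (- 1) (w + fps_const Theta)"

text \<open>On \<open>\<Theta> + \<E>\<close> and on \<open>\<E>\<close>, respectively, the rotated fields are again autonomous.\<close>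

definition remove_rotation :: "'a::field_char_0 vf \<Rightarrow> 'a vf" where
  "remove_rotation v = (THE u. to_rotating_frame (fps_const v) = fps_const u)"

definition restore_rotation :: "'a::field_char_0 vf \<Rightarrow> 'a vf" where
  "restore_rotation u = (THE v. from_rotating_frame (fps_const u) = fps_const v)"

definition Theta_E :: "'a::field_char_0 vf set" where
  "Theta_E = (\<lambda>u. Theta + u) ` E_alg"

section \<open>Permissible transformations\<close>

definition exp_ad :: "'a::field_char_0 vf \<Rightarrow> 'a vf \<Rightarrow> 'a vf" where
  "exp_ad S u = vf_sum (\<lambda>n::nat. vf_scale (1 / fact n) ((lie S ^^ n) u))"

definition permissible :: "('a::field_char_0 vf \<Rightarrow> 'a vf) set" where
  "permissible = generate (BijGroup E_alg)
     ({restrict (exp_ad S) E_alg | S. S \<in> E_alg} \<union>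
      {restrict (\<lambda>u. (1 + T) *s u) E_alg | T. T \<in> R_space})"

text \<open>The near-identity part is preceded by a rescaling of time by a nonzero constant, which commutes
  with it.\<close>

definition transformable :: "'a::field_char_0 vf \<Rightarrow> 'a vf \<Rightarrow> bool" where
  "transformable v v' \<longleftrightarrow>
     (\<exists>c g. c \<noteq> 0 \<and> g \<in> permissible \<and>
        v' = restore_rotation (g (vf_scale c (remove_rotation v))))"

section \<open>Simplest orbital normal form\<close>

text \<open>A tuple \<open>(Y\<^sub>n, Y\<^sub>n\<^sub>-\<^sub>1, \<dots>, Y\<^sub>n\<^sub>-\<^sub>k\<^sub>+\<^sub>1)\<close> is the list of its entries in this order, so that the
  entry at position i has grade \<open>n - i\<close>. The map \<open>d\<^sup>n\<^sup>,\<^sup>k\<close> is \<open>d_map\<close> on the domain \<open>d_dom u n k\<close>;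
  \<open>k = 0\<close> only serves as the start of the recursion (\<open>d_dom u n 1\<close> consists of the lists \<open>[Y]\<close>
  with \<open>Y\<close> in \<open>A\<^sub>n\<close>).\<close>

definition d_map :: "'a::field_char_0 vf \<Rightarrow> ('a vf \<times> 'a ps) list \<Rightarrow> 'a vf" where
  "d_map u Ys = (\<Sum>i<length Ys. act (Ys ! i) (hpart u i))"

fun d_dom :: "'a::field_char_0 vf \<Rightarrow> nat \<Rightarrow> nat \<Rightarrow> ('a vf \<times> 'a ps) list set" where
  "d_dom u n 0 = {[]}"
| "d_dom u n (Suc k) =
     {Y # Ys | Y Ys. Y \<in> A_hom n \<and> Ys \<in> d_dom u (n - 1) k \<and> d_map u Ys = 0}"

definition d_image :: "'a::field_char_0 vf \<Rightarrow> nat \<Rightarrow> nat \<Rightarrow> 'a vf set" where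
  "d_image u n k = d_map u ` d_dom u n k"

definition complement_in :: "'a::field_char_0 vf set \<Rightarrow> 'a vf set \<Rightarrow> 'a vf set \<Rightarrow> bool" where
  "complement_in V W C \<longleftrightarrow>
     vf.subspace C \<and> C \<inter> W = {0} \<and> {a + b | a b. a \<in> C \<and> b \<in> W} = V"

definition simplest_orbital_nf :: "'a::field_char_0 vf \<Rightarrow> bool" where
  "simplest_orbital_nf v \<longleftrightarrow> v \<in> Theta_E \<and>
     (let u = remove_rotation v in
      \<exists>C. (\<forall>n k. 1 \<le> k \<and> k \<le> n \<longrightarrow> complement_in (E_hom n) (d_image u n k) (C n k)) \<and>
          (\<forall>n\<ge>1. hpart u n \<in> C n n))"

section \<open>Symmetries\<close>

definition conj_rotation :: "('a::field_char_0 vf \<Rightarrow> 'a vf) \<Rightarrow> 'a vf \<Rightarrow> 'a vf" where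
  "conj_rotation g = (\<lambda>v \<in> Theta_E. restore_rotation (g (remove_rotation v)))"

definition symmetry_group :: "'a::field_char_0 vf \<Rightarrow> ('a vf \<Rightarrow> 'a vf) monoid" where
  "symmetry_group v = (BijGroup Theta_E)
     \<lparr>carrier := {conj_rotation g | g. g \<in> permissible \<and> g (remove_rotation v) = remove_rotation v}\<rparr>"

definition finitely_generated_group :: "('g, 'h) monoid_scheme \<Rightarrow> bool" where
  "finitely_generated_group G \<longleftrightarrow>
     (\<exists>H. finite H \<and> H \<subseteq> carrier G \<and> generate G H = carrier G)"

definition symmetry_generators :: "'a::field_char_0 vf \<Rightarrow> ('a vf \<times> 'a ps) set" where
  "symmetry_generators v = {Y \<in> A_space. act Y (remove_rotation v) = 0}"

definition trivial_state_symmetry :: "'a::field_char_0 vf \<Rightarrow> 'a vf \<Rightarrow> bool" where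
  "trivial_state_symmetry v S \<longleftrightarrow> (\<exists>c. S = vf_scale c (remove_rotation v))"

definition orbital_nf :: "nat \<Rightarrow> 'a::field_char_0 \<Rightarrow> 'a \<Rightarrow> 'a vf" where
  "orbital_nf r b1 br = Theta + Emon 1 1 + vf_scale b1 (Emon 0 1) + vf_scale br (Emon 0 r)"

end

theory Submission
  imports Defs "HOL-Computational_Algebra.Polynomial" "HOL-Library.Countable_Set"
begin

text \<open>
  Put \<open>\<rho> = y\<^sup>2 + z\<^sup>2\<close> and \<open>s = x / \<rho>\<close>. Then \<open>Z\<^sup>m\<^sub>n = s\<^sup>m \<rho>\<^sup>n\<close>, so a formal sum of the \<open>Z\<^sup>m\<^sub>n\<close> with
  \<open>m \<le> n\<close> is a power series in \<open>\<rho>\<close> whose coefficient of \<open>\<rho>\<^sup>n\<close> is a polynomial in \<open>s\<close> of degree at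
  most \<open>n\<close>. The Euler field \<open>E\<close> kills \<open>s\<close> and fixes \<open>\<rho>\<close>, hence acts as \<open>\<rho> d/d\<rho>\<close>. Consequently the Lie
  algebra is a space of vector fields on a line, \<open>f E\<close> with \<open>f\<close> a power series in \<open>\<rho>\<close>,
  where \<open>s\<close> is a parameter and \<open>[f E, g E] = (f E(g) - g E(f)) E\<close>. The rotation field commutes with
  everything in sight, so passing to the rotating frame just removes it. All computations are carried
  out with such series \<open>f\<close>, and nearly all of them compare coefficients at the lowest power of \<open>\<rho>\<close>.

  Normal form. After a constant rescaling, \<open>f = (s + b) \<rho> + \<dots>\<close>. A time rescaling
  divides every higher coefficient by \<open>s + b\<close> with remainder, which leaves
  \<open>f = \<rho> (s + b + h(\<rho>))\<close> with \<open>h\<close> free of \<open>s\<close> (\<open>weierstrass_preparation\<close>; in other words,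
  \<open>f\<close> is a unit times the defining function of a curve \<open>x = \<phi>(\<rho>)\<close>). A field
  \<open>\<psi>(\<rho>) E\<close> moves that curve by a reparametrization of \<open>\<rho>\<close> which changes \<open>h\<close> by composition, and in
  characteristic zero a series \<open>h = c \<rho>\<^sup>r\<^sup>-\<^sup>1 + \<dots>\<close> can be straightened to \<open>c \<rho>\<^sup>r\<^sup>-\<^sup>1\<close>. Permissible
  transformations are finite products of exponentials and rescalings, so \<open>\<psi>\<close> has to be found in one
  piece; the equation for it is triangular with pivot \<open>(r - 1) c\<close> (\<open>straighten_to_monomial\<close>).
  A last time rescaling gives \<open>f = (s + b) \<rho> + c \<rho>\<^sup>r\<close>.

  Simplest. The image of \<open>d\<^sup>n\<^sup>,\<^sup>n\<close> consists of the grade \<open>n\<close> parts of those \<open>(S, T) * u\<close> all of whose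
  lower parts vanish (\<open>d_image_leading_part\<close>). For the normal form,
  \<open>(S, T) * u = q f + (r - 1) c \<rho>\<^sup>r g\<close> with \<open>q\<close> and \<open>g\<close> of order at least one in \<open>\<rho>\<close>. Up to the power
  \<open>\<rho>\<^sup>r\<close> its coefficients are multiples of \<open>s + b\<close>, and the first one is zero; so no
  nonzero homogeneous part of \<open>f\<close> can occur as such a leading part, and a complement containing it
  exists.

  Symmetries. For each \<open>h\<close> the exponential of \<open>h u\<close> multiplies \<open>u\<close> by a unit, because
  \<open>[F h, F q] = F (F [h, q])\<close>, and a time rescaling undoes this. Different
  \<open>h\<close> give different symmetries (\<open>symmetry_determines_parameter\<close>), so letting \<open>h\<close> range over the series
  with coefficients 0 and 1 yields uncountably many, whereas a finitely generated group is
  countable. If \<open>c \<noteq> 0\<close> and \<open>g E\<close> commutes with \<open>u\<close>, the coefficient recursion for \<open>g\<close> at the power \<open>\<rho>\<^sup>r\<^sup>+\<^sup>1\<close>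
  forces the leading coefficient of \<open>g\<close> to vanish at \<open>s = - b\<close>, i.e. to be a multiple of \<open>s + b\<close>, and all
  other coefficients are determined by it; hence \<open>g\<close> is a multiple of \<open>f\<close>
  (\<open>commuting_with_nf_series\<close>).
\<close>

notation fps_nth (infixl "$$" 75)

section \<open>Coefficients and derivations of F[[x, y, z]]\<close>

lemma ps_eqI: "(\<And>a b c. ps_coeff f a b c = ps_coeff g a b c) \<Longrightarrow> f = g"
  by (auto simp: fps_eq_iff ps_coeff_def)

lemma ps_coeff_simps [simp]:
  "ps_coeff (f + g) a b c = ps_coeff f a b c + ps_coeff g a b c"
  "ps_coeff (f - g) a b c = ps_coeff f a b c - ps_coeff g a b c"
  "ps_coeff (- f) a b c = - ps_coeff f a b c"
  "ps_coeff 0 a b c = 0"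
  "ps_coeff (ps_const k * f) a b c = k * ps_coeff f a b c"
  for f g :: "'a::field_char_0 ps"
  by (simp_all add: ps_coeff_def ps_const_def)

lemma ps_coeff_one: "ps_coeff 1 a b c = (if a = 0 \<and> b = 0 \<and> c = 0 then 1 else 0)"
  by (simp add: ps_coeff_def)

lemma ps_coeff_sum: "ps_coeff (\<Sum>i\<in>I. f i) a b c = (\<Sum>i\<in>I. ps_coeff (f i) a b c)"
  for f :: "'i \<Rightarrow> 'a::field_char_0 ps"
  by (induction I rule: infinite_finite_induct) simp_all

lemma ps_coeff_mult:
  "ps_coeff (f * g) a b c =
    (\<Sum>k\<le>c. \<Sum>j\<le>b. \<Sum>i\<le>a. ps_coeff f i j k * ps_coeff g (a - i) (b - j) (c - k))"
  for f g :: "'a::field_char_0 ps"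
  by (simp add: ps_coeff_def fps_mult_nth fps_sum_nth atLeast0AtMost)

lemma ps_coeff_var_mult [simp]:
  "ps_coeff (var_x * f) a b c = (if a = 0 then 0 else ps_coeff f (a - 1) b c)"
  "ps_coeff (var_y * f) a b c = (if b = 0 then 0 else ps_coeff f a (b - 1) c)"
  "ps_coeff (var_z * f) a b c = (if c = 0 then 0 else ps_coeff f a b (c - 1))"
  for f :: "'a::field_char_0 ps"
  by (simp_all add: ps_coeff_def var_x_def var_y_def var_z_def)

lemma ps_coeff_deriv [simp]:
  "ps_coeff (d_x f) a b c = of_nat (Suc a) * ps_coeff f (Suc a) b c"
  "ps_coeff (d_y f) a b c = of_nat (Suc b) * ps_coeff f a (Suc b) c"
  "ps_coeff (d_z f) a b c = of_nat (Suc c) * ps_coeff f a b (Suc c)"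
  for f :: "'a::field_char_0 ps"
  by (simp_all add: ps_coeff_def d_x_def d_y_def d_z_def fps_of_nat[symmetric] del: of_nat_Suc)

lemma d_x_mult: "d_x (f * g) = d_x f * g + f * d_x g" for f g :: "'a::field_char_0 ps"
  by (simp add: fps_eq_iff d_x_def fps_mult_nth fps_deriv_sum sum.distrib fps_sum_nth)

lemma d_y_mult: "d_y (f * g) = d_y f * g + f * d_y g" for f g :: "'a::field_char_0 ps"
  by (simp add: fps_eq_iff d_y_def fps_mult_nth fps_deriv_sum sum.distrib fps_sum_nth)

lemma d_z_mult: "d_z (f * g) = d_z f * g + f * d_z g" for f g :: "'a::field_char_0 ps"
  by (simp add: d_z_def algebra_simps)

lemma d_add [simp]:
  "d_x (f + g) = d_x f + d_x g" "d_y (f + g) = d_y f + d_y g" "d_z (f + g) = d_z f + d_z g"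
  for f g :: "'a::field_char_0 ps"
  by (auto intro!: ps_eqI simp: algebra_simps)

lemma vf_apply_mult: "vf_apply X (f * g) = vf_apply X f * g + f * vf_apply X g"
  by (simp add: vf_apply_def d_x_mult d_y_mult d_z_mult algebra_simps)

lemma vf_apply_scale: "vf_apply (h *s X) f = h * vf_apply X f"
  by (simp add: vf_apply_def algebra_simps)

lemma vf_apply_add: "vf_apply (X + Y) f = vf_apply X f + vf_apply Y f"
  by (simp add: vf_apply_def algebra_simps)

lemma vf_apply_add_right: "vf_apply X (f + g) = vf_apply X f + vf_apply X g"
  by (simp add: vf_apply_def algebra_simps)

lemma lie_scale_scale:
  "lie (f *s X) (g *s X) = (f * vf_apply X g - g * vf_apply X f) *s X"
  by (simp add: lie_def vec_eq_iff vf_apply_scale vf_apply_mult algebra_simps)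

lemma lie_scale_right: "lie X (g *s Y) = vf_apply X g *s Y + g *s lie X Y"
  by (simp add: lie_def vec_eq_iff vf_apply_scale vf_apply_mult algebra_simps)

lemma lie_add_left: "lie (X + Y) Z = lie X Z + lie Y Z"
  by (simp add: lie_def vec_eq_iff vf_apply_add vf_apply_add_right)

lemma lie_add_right: "lie X (Y + Z) = lie X Y + lie X Z"
  by (simp add: lie_def vec_eq_iff vf_apply_add vf_apply_add_right)

lemma lie_self: "lie X X = 0"
  by (simp add: lie_def vec_eq_iff)

lemma lie_zero_right [simp]: "lie X 0 = 0"
  by (metis add_cancel_right_right lie_add_right)

section \<open>Power series in \<open>\<rho>\<close> over the polynomials in \<open>s\<close>\<close>

text \<open>
  The outer variable \<open>fps_X\<close> is \<open>\<rho>\<close>, and the coefficients are polynomials in \<open>s = x / \<rho>\<close>. The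
  monomial \<open>s\<^sup>l \<rho>\<^sup>k\<close> equals \<open>x\<^sup>l \<rho>\<^sup>k\<^sup>-\<^sup>l\<close>, which is a power series in x, y, z only if \<open>l \<le> k\<close>.
\<close>

definition degree_bounded :: "'a::zero poly fps \<Rightarrow> bool" where
  "degree_bounded F \<longleftrightarrow> (\<forall>k. degree (F $$ k) \<le> k)"

text \<open>
  The power series in x, y, z obtained by substituting \<open>\<rho> = y\<^sup>2 + z\<^sup>2\<close> and \<open>s = x / \<rho>\<close>, written
  out by the binomial theorem: the term \<open>x\<^sup>a \<rho>\<^sup>j\<close> is \<open>s\<^sup>a \<rho>\<^sup>a\<^sup>+\<^sup>j\<close>, and \<open>y\<^sup>b z\<^sup>c\<close> occurs in
  \<open>\<rho>\<^sup>j\<close> for \<open>b + c = 2 j\<close> with b and c even.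
\<close>

definition to_ps :: "'a::field_char_0 poly fps \<Rightarrow> 'a ps" where
  "to_ps F = Abs_fps (\<lambda>c. Abs_fps (\<lambda>b. Abs_fps (\<lambda>a.
     if even b \<and> even c
     then of_nat ((b + c) div 2 choose (c div 2)) * coeff (F $$ (a + (b + c) div 2)) a else 0)))"

lemma ps_coeff_to_ps:
  "ps_coeff (to_ps F) a b c =
     (if even b \<and> even c
      then of_nat ((b + c) div 2 choose (c div 2)) * coeff (F $$ (a + (b + c) div 2)) a else 0)"
  by (simp add: to_ps_def ps_coeff_def)

lemma to_ps_add: "to_ps (F + G) = to_ps F + to_ps G"
  by (rule ps_eqI) (simp add: ps_coeff_to_ps algebra_simps)

lemma to_ps_diff: "to_ps (F - G) = to_ps F - to_ps G"
  by (rule ps_eqI) (simp add: ps_coeff_to_ps algebra_simps)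

lemma to_ps_zero [simp]: "to_ps 0 = 0"
  by (rule ps_eqI) (simp add: ps_coeff_to_ps)

lemma to_ps_one: "to_ps 1 = 1"
  by (rule ps_eqI) (auto simp: ps_coeff_to_ps ps_coeff_one elim!: evenE)

lemma to_ps_const_mult: "to_ps (fps_const [:k:] * F) = ps_const k * to_ps F"
  by (rule ps_eqI) (simp add: ps_coeff_to_ps algebra_simps)

lemma to_ps_x_mult: "to_ps (fps_const [:0, 1:] * (fps_X * F)) = var_x * to_ps F"
proof (rule ps_eqI)
  fix a b c
  show "ps_coeff (to_ps (fps_const [:0, 1:] * (fps_X * F))) a b c = ps_coeff (var_x * to_ps F) a b c"
    by (cases a) (auto simp: ps_coeff_to_ps coeff_pCons)
qed

text \<open>
  On coefficients this is Pascal's rule. The degree bound excludes the term \<open>s\<^sup>a \<rho>\<^sup>a\<^sup>-\<^sup>1\<close> of F,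
  which contributes to the product but is invisible in \<open>to_ps F\<close>.
\<close>

lemma to_ps_rho_mult:
  assumes "degree_bounded F"
  shows "to_ps (fps_X * F) = (var_y ^ 2 + var_z ^ 2) * to_ps F"
proof (rule ps_eqI)
  fix a b c
  have pow: "(var_y ^ 2 + var_z ^ 2) * to_ps F =
      var_y * (var_y * to_ps F) + var_z * (var_z * to_ps F)"
    by (simp add: algebra_simps power2_eq_square)
  show "ps_coeff (to_ps (fps_X * F)) a b c = ps_coeff ((var_y ^ 2 + var_z ^ 2) * to_ps F) a b c"
  proof (cases "even b \<and> even c")
    case True
    then obtain p q where [simp]: "b = 2 * p" "c = 2 * q" by (elim conjE evenE)
    show ?thesis
    proof (cases p; cases q)
      fix p' q' assume [simp]: "p = Suc p'" "q = Suc q'"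
      have "Suc p' + Suc q' choose Suc q' = (p' + Suc q' choose Suc q') + (Suc p' + q' choose q')"
        by simp
      then show ?thesis
        unfolding pow by (simp add: ps_coeff_to_ps algebra_simps)
    next
      assume "p = 0" "q = 0"
      moreover have "coeff (F $$ (a - Suc 0)) a = 0" if "a > 0"
        using assms that by (intro coeff_eq_0) (metis Suc_pred' degree_bounded_def le_imp_less_Suc One_nat_def)
      ultimately show ?thesis
        by (simp add: pow ps_coeff_to_ps)
    qed (simp_all add: pow ps_coeff_to_ps)
  next
    case False
    then show ?thesis
      unfolding pow by (auto simp: ps_coeff_to_ps)
  qed
qed

text \<open>
  The monomial \<open>s\<^sup>l \<rho>\<^sup>k\<close> has total degree at least k in x, y, z, so the coefficient at exponents
  a, b, c only sees powers of \<open>\<rho>\<close> up to \<open>a + b + c\<close>. This reduces identities between series to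
  identities between finite sums.
\<close>

lemma ps_coeff_to_ps_mult_cong:
  assumes "\<And>k. k \<le> a + b + c \<Longrightarrow> F $$ k = F' $$ k"
  shows "ps_coeff (to_ps F * h) a b c = ps_coeff (to_ps F' * h) a b c"
  unfolding ps_coeff_mult by (intro sum.cong refl arg_cong2[where f = "(*)"])
    (auto simp: ps_coeff_to_ps assms)

lemma ps_coeff_to_ps_cong:
  assumes "\<And>k. k \<le> a + b + c \<Longrightarrow> F $$ k = F' $$ k"
  shows "ps_coeff (to_ps F) a b c = ps_coeff (to_ps F') a b c"
  using ps_coeff_to_ps_mult_cong[OF assms, where h = 1] by simp

lemma degree_bounded_coeff: "degree_bounded F \<longleftrightarrow> (\<forall>k l. coeff (F $$ k) l \<noteq> 0 \<longrightarrow> l \<le> k)"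
  unfolding degree_bounded_def by (meson coeff_eq_0 degree_le le_degree linorder_not_less order_trans)

lemma degree_bounded_zero [simp]: "degree_bounded 0"
  by (simp add: degree_bounded_def)

lemma degree_bounded_const [simp]: "degree_bounded (fps_const [:k:])"
  by (simp add: degree_bounded_def)

lemma degree_bounded_one [simp]: "degree_bounded 1"
  by (simp add: degree_bounded_def)

lemma degree_bounded_fps_X [simp]: "degree_bounded fps_X"
  by (simp add: degree_bounded_def fps_X_def)

lemma degree_bounded_x [simp]: "degree_bounded (fps_const [:0, 1:] * fps_X :: 'a::field_char_0 poly fps)"
  by (simp add: degree_bounded_def)

lemma degree_bounded_add [intro]: "degree_bounded F \<Longrightarrow> degree_bounded G \<Longrightarrow> degree_bounded (F + G)"
  by (simp add: degree_bounded_def degree_add_le)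

lemma degree_bounded_diff [intro]: "degree_bounded F \<Longrightarrow> degree_bounded G \<Longrightarrow> degree_bounded (F - G)" for F :: "'a::field_char_0 poly fps"
  by (simp add: degree_bounded_def degree_diff_le)

lemma degree_bounded_mult [intro]: "degree_bounded F \<Longrightarrow> degree_bounded G \<Longrightarrow> degree_bounded (F * G)" for F :: "'a::field_char_0 poly fps"
  unfolding degree_bounded_def fps_mult_nth
proof (intro allI degree_sum_le)
  fix k i :: nat assume *: "\<forall>k. degree (F $$ k) \<le> k" "\<forall>k. degree (G $$ k) \<le> k" "i \<in> {0..k}"
  have "degree (F $$ i * G $$ (k - i)) \<le> degree (F $$ i) + degree (G $$ (k - i))"
    by (rule degree_mult_le)
  also have "\<dots> \<le> i + (k - i)"
    using * by (intro add_mono) auto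
  finally show "degree (F $$ i * G $$ (k - i)) \<le> k"
    using *(3) by simp
qed auto

lemma degree_bounded_XD [intro]: "degree_bounded F \<Longrightarrow> degree_bounded (fps_XD F)" for F :: "'a::field_char_0 poly fps"
proof -
  have "degree (of_nat k * F $$ k) \<le> degree (F $$ k)" for k
    by (simp add: of_nat_poly)
  then show "degree_bounded F \<Longrightarrow> degree_bounded (fps_XD F)"
    by (auto simp: degree_bounded_def intro: order_trans)
qed

text \<open>
  The series F for which \<open>to_ps\<close> respects multiplication by F. They form a ring that contains
  \<open>x = s \<rho>\<close>, \<open>\<rho>\<close> and the constants, which is enough by truncation.
\<close>

definition multiplicative_to_ps :: "'a::field_char_0 poly fps \<Rightarrow> bool" where
  "multiplicative_to_ps F \<longleftrightarrow> degree_bounded F \<and> (\<forall>G. degree_bounded G \<longrightarrow> to_ps (F * G) = to_ps F * to_ps G)"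

lemma multiplicative_to_ps_closed:
  fixes F F' :: "'a::field_char_0 poly fps" and H :: "'i \<Rightarrow> 'a poly fps"
  shows "multiplicative_to_ps (fps_const [:0, 1:] * fps_X :: 'a poly fps)"
  "multiplicative_to_ps (fps_X :: 'a poly fps)"
  "multiplicative_to_ps (fps_const [:k :: 'a:])"
  "multiplicative_to_ps F \<Longrightarrow> multiplicative_to_ps F' \<Longrightarrow> multiplicative_to_ps (F * F')"
  "multiplicative_to_ps F \<Longrightarrow> multiplicative_to_ps F' \<Longrightarrow> multiplicative_to_ps (F + F')"
  "multiplicative_to_ps F \<Longrightarrow> multiplicative_to_ps (F ^ n)"
  "(\<And>i. i \<in> I \<Longrightarrow> multiplicative_to_ps (H i)) \<Longrightarrow> multiplicative_to_ps (\<Sum>i\<in>I. H i)"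
proof -
  show "multiplicative_to_ps (fps_const [:0, 1:] * fps_X :: 'a poly fps)"
    using to_ps_x_mult[of "1 :: 'a poly fps"] by (auto simp add: mult.assoc multiplicative_to_ps_def to_ps_x_mult to_ps_one)
  show "multiplicative_to_ps (fps_X :: 'a poly fps)"
    using to_ps_rho_mult[of "1 :: 'a poly fps"] by (simp add: multiplicative_to_ps_def to_ps_rho_mult to_ps_one)
  show "multiplicative_to_ps (fps_const [:k:])" for k :: 'a
    using to_ps_const_mult[of k 1] by (simp add: multiplicative_to_ps_def to_ps_const_mult to_ps_one)
  show mult: "multiplicative_to_ps (F * F')"
    if "multiplicative_to_ps F" "multiplicative_to_ps F'" for F F' :: "'a poly fps"
    using that by (auto simp add: multiplicative_to_ps_def mult.assoc degree_bounded_mult)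
  show add: "multiplicative_to_ps (F + F')"
    if "multiplicative_to_ps F" "multiplicative_to_ps F'" for F F' :: "'a poly fps"
    using that by (auto simp add: multiplicative_to_ps_def distrib_right to_ps_add)
  have one: "multiplicative_to_ps (1 :: 'a poly fps)"
    by (simp add: multiplicative_to_ps_def to_ps_one)
  show "multiplicative_to_ps (F ^ n)" if "multiplicative_to_ps F" for F :: "'a poly fps" and n
    using that by (induction n) (auto simp: one mult)
  show "multiplicative_to_ps (\<Sum>i\<in>I. H i)" if "\<And>i. i \<in> I \<Longrightarrow> multiplicative_to_ps (H i)"
    for I and H :: "'i \<Rightarrow> 'a poly fps"
    using that
    by (induction I rule: infinite_finite_induct) (auto simp: add, auto simp: multiplicative_to_ps_def)
qed

definition mono_fps :: "nat \<Rightarrow> nat \<Rightarrow> 'a::field_char_0 poly fps" where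
  "mono_fps l k = fps_const (monom 1 l) * fps_X ^ k"

lemma mono_fps_eq:
  assumes "l \<le> k"
  shows "mono_fps l k = (fps_const [:0, 1:] * fps_X) ^ l * fps_X ^ (k - l)"
proof -
  have "(fps_const [:0, 1:] * fps_X) ^ l * fps_X ^ (k - l) =
      fps_const ([:0, 1:] ^ l) * (fps_X ^ l * fps_X ^ (k - l) :: 'a poly fps)"
    by (simp add: power_mult_distrib fps_const_power mult.assoc)
  also have "fps_X ^ l * fps_X ^ (k - l) = (fps_X ^ k :: 'a poly fps)"
    using assms by (simp flip: power_add)
  also have "[:0, 1:] ^ l = (monom 1 l :: 'a poly)"
    by (simp add: monom_altdef)
  finally show ?thesis by (simp add: mono_fps_def)
qed

lemma multiplicative_to_ps_mono: "l \<le> k \<Longrightarrow> multiplicative_to_ps (mono_fps l k)"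
  by (simp add: mono_fps_eq multiplicative_to_ps_closed)

lemma to_ps_mono: "l \<le> k \<Longrightarrow> to_ps (mono_fps l k) = Zmon l k"
proof -
  have x: "to_ps ((fps_const [:0, 1:] * fps_X) ^ m * F) = var_x ^ m * to_ps F" for m and F :: "'a poly fps"
    by (induction m arbitrary: F) (simp_all add: mult.assoc to_ps_x_mult)
  have degree_bounded: "degree_bounded (fps_X ^ m :: 'a poly fps)" for m
    by (induction m) auto
  have \<rho>: "to_ps (fps_X ^ m) = ((var_y ^ 2 + var_z ^ 2) ^ m :: 'a ps)" for m
    by (induction m) (simp_all add: to_ps_rho_mult to_ps_one degree_bounded)
  assume "l \<le> k"
  then show ?thesis by (simp add: mono_fps_eq x \<rho> Zmon_def)
qed

lemma degree_bounded_expansion: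
  assumes "degree_bounded F" "k \<le> N"
  shows "F $$ k = (\<Sum>j\<le>N. \<Sum>l\<le>j. fps_const [:coeff (F $$ j) l:] * mono_fps l j) $$ k"
proof -
  have inner: "(\<Sum>l\<le>j. fps_const [:coeff (F $$ j) l:] * mono_fps l j) $$ k = (if j = k then F $$ k else 0)" for j
  proof (cases "j = k")
    case True
    have "(\<Sum>l\<le>k. fps_const [:coeff (F $$ k) l:] * mono_fps l k) $$ k = (\<Sum>l\<le>k. monom (coeff (F $$ k) l) l)"
      by (simp add: fps_sum_nth mono_fps_def smult_monom)
    also have "\<dots> = F $$ k"
      using assms(1) by (intro poly_as_sum_of_monoms') (simp add: degree_bounded_def)
    finally show ?thesis using True by simp
  qed (simp add: fps_sum_nth mono_fps_def)
  show ?thesis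
    unfolding fps_sum_nth[where S = "{..N}"] inner using assms(2) by simp
qed

lemma to_ps_mult:
  assumes "degree_bounded F" "degree_bounded G"
  shows "to_ps (F * G) = to_ps F * to_ps G"
proof (rule ps_eqI)
  fix a b c
  define T where "T = (\<Sum>j\<le>a+b+c. \<Sum>l\<le>j. fps_const [:coeff (F $$ j) l:] * mono_fps l j)"
  have T: "F $$ k = T $$ k" if "k \<le> a + b + c" for k
    unfolding T_def by (rule degree_bounded_expansion[OF assms(1) that])
  have "multiplicative_to_ps T"
    unfolding T_def by (intro multiplicative_to_ps_closed multiplicative_to_ps_mono) auto
  then have "to_ps (T * G) = to_ps T * to_ps G"
    using assms by (simp add: multiplicative_to_ps_def)
  moreover have "ps_coeff (to_ps (F * G)) a b c = ps_coeff (to_ps (T * G)) a b c"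
    by (rule ps_coeff_to_ps_cong) (auto simp: fps_mult_nth T intro!: sum.cong)
  moreover have "ps_coeff (to_ps F * to_ps G) a b c = ps_coeff (to_ps T * to_ps G) a b c"
    by (rule ps_coeff_to_ps_mult_cong) (rule T)
  ultimately show "ps_coeff (to_ps (F * G)) a b c = ps_coeff (to_ps F * to_ps G) a b c"
    by simp
qed

text \<open>
  E multiplies \<open>x\<^sup>a y\<^sup>b z\<^sup>c\<close> by \<open>a + (b + c) / 2\<close>, which is the exponent of \<open>\<rho>\<close> in \<open>s\<^sup>a \<rho>\<^sup>k\<close>
  with \<open>k = a + (b + c) / 2\<close>.
\<close>

lemma vf_apply_Eul_to_ps: "vf_apply Eul (to_ps F) = to_ps (fps_XD F)"
proof (rule ps_eqI)
  fix a b c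
  have euler: "vf_apply Eul f =
      var_x * d_x f + ps_const (1/2) * (var_y * d_y f) + ps_const (1/2) * (var_z * d_z f)" for f :: "'a ps"
    by (simp add: vf_apply_def Eul_def mult.assoc)
  have weight: "ps_coeff (vf_apply Eul f) a b c = (of_nat a + (of_nat b + of_nat c) / 2) * ps_coeff f a b c"
    for f :: "'a ps"
    unfolding euler by (cases a; cases b; cases c) (simp_all, simp_all add: field_simps)
  show "ps_coeff (vf_apply Eul (to_ps F)) a b c = ps_coeff (to_ps (fps_XD F)) a b c"
    unfolding weight by (auto simp: ps_coeff_to_ps of_nat_poly field_simps elim!: evenE)
qed

text \<open>
  The coefficients of powers of \<open>y\<^sup>2 + z\<^sup>2\<close> at \<open>y\<^sup>b\<^sup>+\<^sup>1 z\<^sup>c\<^sup>-\<^sup>1\<close> and \<open>y\<^sup>b\<^sup>-\<^sup>1 z\<^sup>c\<^sup>+\<^sup>1\<close> are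
  neighbouring binomial coefficients, which cancel by the absorption identity.
\<close>

lemma vf_apply_Theta_to_ps: "vf_apply Theta (to_ps F) = 0"
proof (rule ps_eqI)
  fix a b c
  have rot: "vf_apply Theta f = var_z * d_y f - var_y * d_z f" for f :: "'a ps"
    by (simp add: vf_apply_def Theta_def)
  have absorb: "of_nat (2 * Suc p) * of_nat (Suc (p + q) choose q) * x =
       of_nat (2 * Suc q) * of_nat (Suc (p + q) choose Suc q) * (x :: 'a)" for p q x
    using Suc_times_binomial_add[of q p] by (simp only: mult.assoc flip: of_nat_mult) (simp add: ac_simps)
  show "ps_coeff (vf_apply Theta (to_ps F)) a b c = ps_coeff 0 a b c"
  proof (cases "odd b \<and> odd c")
    case True
    then obtain p q where [simp]: "b = Suc (2 * p)" "c = Suc (2 * q)" by (elim conjE oddE) simp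
    have 1: "(Suc (Suc (2 * p)) + 2 * q) div 2 = Suc (p + q)" "(2 * p + Suc (Suc (2 * q))) div 2 = Suc (p + q)"
      by simp_all
    show ?thesis
      unfolding rot using absorb[of p q "coeff (F $$ Suc (a + (p + q))) a"]
      by (simp add: ps_coeff_to_ps 1 algebra_simps del: binomial_Suc_Suc)
  next
    case False
    then show ?thesis
      unfolding rot by (auto simp: ps_coeff_to_ps)
  qed
qed

lemma ps_coeff_var:
  "ps_coeff (var_x :: 'a::field_char_0 ps) a b c = (if a = 1 \<and> b = 0 \<and> c = 0 then 1 else 0)"
  "ps_coeff (var_y :: 'a ps) a b c = (if a = 0 \<and> b = 1 \<and> c = 0 then 1 else 0)"
  "ps_coeff (var_z :: 'a ps) a b c = (if a = 0 \<and> b = 0 \<and> c = 1 then 1 else 0)"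
  using ps_coeff_var_mult[of "1 :: 'a ps"] by (auto simp: ps_coeff_one)

lemma d_var:
  "d_x (var_x :: 'a::field_char_0 ps) = 1" "d_y (var_x :: 'a ps) = 0" "d_z (var_x :: 'a ps) = 0"
  "d_x (var_y :: 'a ps) = 0" "d_y (var_y :: 'a ps) = 1" "d_z (var_y :: 'a ps) = 0"
  "d_x (var_z :: 'a ps) = 0" "d_y (var_z :: 'a ps) = 0" "d_z (var_z :: 'a ps) = 1"
  by (auto intro!: ps_eqI simp: ps_coeff_var ps_coeff_one)

lemma d_const_mult:
  "d_x (ps_const k * f) = ps_const k * d_x f"
  "d_y (ps_const k * f) = ps_const k * d_y f"
  "d_z (ps_const k * f) = ps_const k * d_z f"
  by (intro ps_eqI, simp only: ps_coeff_simps ps_coeff_deriv mult.left_commute)+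

lemma lie_Theta_Eul: "lie Theta Eul = (0 :: 'a::field_char_0 vf)"
proof -
  have neg: "d_x (- f) = - d_x f" "d_y (- f) = - d_y f" "d_z (- f) = - d_z f" "d_x 0 = 0" "d_y 0 = 0" "d_z 0 = 0"
    for f :: "'a ps"
    by (auto intro!: ps_eqI)
  show ?thesis
    by (simp add: lie_def vec_eq_iff forall_3 vf_apply_def Theta_def Eul_def d_var d_const_mult neg)
qed

lemma lie_Theta_to_ps: "lie Theta (to_ps F *s Eul) = 0"
  by (simp add: lie_scale_right vf_apply_Theta_to_ps lie_Theta_Eul)

section \<open>The Lie algebra as vector fields on a line\<close>

definition radial :: "'a::field_char_0 poly fps \<Rightarrow> 'a vf" where
  "radial F = to_ps F *s Eul"

text \<open>
  The maximal ideal of the ring of degree-bounded series, i.e. of \<open>F[[x, \<rho>]]\<close>. It parametrizes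
  both the Lie algebra and the time rescalings.
\<close>

definition max_ideal :: "'a::field_char_0 poly fps set" where
  "max_ideal = {F. degree_bounded F \<and> F $$ 0 = 0}"

lemma to_ps_inject:
  assumes "degree_bounded F" "degree_bounded G" "to_ps F = to_ps G"
  shows "F = G"
proof (rule fps_ext, rule poly_eqI)
  fix k l
  show "coeff (F $$ k) l = coeff (G $$ k) l"
  proof (cases "l \<le> k")
    case True
    have "ps_coeff (to_ps F) l (2 * (k - l)) 0 = ps_coeff (to_ps G) l (2 * (k - l)) 0"
      using assms by simp
    then show ?thesis using True by (simp add: ps_coeff_to_ps)
  next
    case False
    then show ?thesis using assms by (metis degree_bounded_coeff)
  qed
qed

lemma radial_inject:
  assumes "degree_bounded F" "degree_bounded G" "radial F = radial G"
  shows "F = G"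
proof -
  have "var_x * to_ps F = var_x * to_ps G"
    using arg_cong[OF assms(3), of "\<lambda>X. X $ 1"] by (simp add: radial_def Eul_def mult.commute)
  moreover have "(var_x :: 'a ps) \<noteq> 0"
  proof
    assume "var_x = (0 :: 'a ps)"
    then show False using ps_coeff_var(1)[where 'a = 'a, of 1 0 0] by simp
  qed
  ultimately show ?thesis using to_ps_inject[OF assms(1,2)] by simp
qed

lemma lie_radial:
  assumes "degree_bounded F" "degree_bounded G"
  shows "lie (radial F) (radial G) = radial (F * fps_XD G - G * fps_XD F)"
  using assms by (simp add: radial_def lie_scale_scale vf_apply_Eul_to_ps to_ps_mult to_ps_diff degree_bounded_XD)

lemma to_ps_scale_radial: "degree_bounded F \<Longrightarrow> degree_bounded G \<Longrightarrow> to_ps F *s radial G = radial (F * G)"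
  by (simp add: radial_def to_ps_mult vec_eq_iff mult.assoc)

lemma radial_add: "radial (F + G) = radial F + radial G"
  by (simp add: radial_def to_ps_add vec_eq_iff algebra_simps)

lemma radial_zero [simp]: "radial 0 = 0"
  by (simp add: radial_def)

lemma radial_sum: "radial (\<Sum>i\<in>I. F i) = (\<Sum>i\<in>I. radial (F i))"
  by (induction I rule: infinite_finite_induct) (simp_all add: radial_add)

lemma vf_scale_radial: "vf_scale k (radial F) = radial (fps_const [:k:] * F)"
  by (simp add: radial_def vf_scale_def to_ps_const_mult vec_eq_iff mult.assoc)

lemma lie_Theta_radial [simp]: "lie Theta (radial F) = 0"
  by (simp add: radial_def lie_Theta_to_ps)

lemma Emon_eq: "l \<le> k \<Longrightarrow> Emon l k = radial (mono_fps l k)"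
  by (simp add: Emon_def radial_def to_ps_mono)

lemma ps_sum_coeff:
  assumes "finite I" "\<And>i. i \<notin> I \<Longrightarrow> ps_coeff (F i) a b c = 0"
  shows "ps_coeff (ps_sum F) a b c = (\<Sum>i\<in>I. ps_coeff (F i) a b c)"
proof -
  have "ps_coeff (ps_sum F) a b c = Sum_any (\<lambda>i. ps_coeff (F i) a b c)"
    by (simp add: ps_sum_def ps_coeff_def)
  also have "\<dots> = (\<Sum>i\<in>I. ps_coeff (F i) a b c)"
    by (rule Sum_any.expand_superset) (use assms in auto)
  finally show ?thesis .
qed

text \<open>
  Coefficientwise sums of fields can be computed on the series in \<open>\<rho>\<close>, provided that each power
  of \<open>\<rho>\<close> receives only finitely many contributions.
\<close>

lemma vf_sum_radial:
  fixes H :: "'i \<Rightarrow> 'a::field_char_0 poly fps"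
  assumes fin: "\<And>N. finite (I N)"
    and small: "\<And>N i k. i \<notin> I N \<Longrightarrow> k \<le> N \<Longrightarrow> H i $$ k = 0"
    and F: "\<And>N k. k \<le> N \<Longrightarrow> F $$ k = (\<Sum>i\<in>I N. H i $$ k)"
  shows "vf_sum (\<lambda>i. radial (H i)) = radial F" and "ps_sum (\<lambda>i. to_ps (H i)) = to_ps F"
proof -
  have mult: "ps_sum (\<lambda>i. to_ps (H i) * g) = to_ps F * g" for g
  proof (rule ps_eqI)
    fix a b c
    let ?I = "I (a + b + c)"
    have "ps_coeff (to_ps (H i) * g) a b c = 0" if "i \<notin> ?I" for i
    proof -
      have "ps_coeff (to_ps (H i) * g) a b c = ps_coeff (to_ps 0 * g) a b c"
        by (rule ps_coeff_to_ps_mult_cong) (use small that in auto)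
      then show ?thesis by simp
    qed
    then have "ps_coeff (ps_sum (\<lambda>i. to_ps (H i) * g)) a b c = (\<Sum>i\<in>?I. ps_coeff (to_ps (H i) * g) a b c)"
      by (intro ps_sum_coeff fin)
    also have "\<dots> = ps_coeff (to_ps (\<Sum>i\<in>?I. H i) * g) a b c"
    proof -
      have "to_ps (\<Sum>i\<in>?I. H i) = (\<Sum>i\<in>?I. to_ps (H i))"
        using fin[of "a + b + c"] by (induction rule: finite_induct) (simp_all add: to_ps_add)
      then show ?thesis by (simp add: sum_distrib_right ps_coeff_sum)
    qed
    also have "\<dots> = ps_coeff (to_ps F * g) a b c"
      by (rule ps_coeff_to_ps_mult_cong) (simp add: F fps_sum_nth)
    finally show "ps_coeff (ps_sum (\<lambda>i. to_ps (H i) * g)) a b c = ps_coeff (to_ps F * g) a b c" .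
  qed
  show "vf_sum (\<lambda>i. radial (H i)) = radial F"
    by (simp add: vf_sum_def radial_def vec_eq_iff mult)
  show "ps_sum (\<lambda>i. to_ps (H i)) = to_ps F"
    using mult[of 1] by simp
qed

lemma series_eq:
  assumes supp: "\<And>l k. \<beta> l k \<noteq> 0 \<Longrightarrow> l \<le> k" and F: "\<And>l k. coeff (F $$ k) l = \<beta> l k"
  shows "E_series \<beta> = radial F" and "R_series \<beta> = to_ps F"
proof -
  define H where "H = (\<lambda>(l, k). fps_const [:\<beta> l k:] * mono_fps l k)"
  define I where "I N = {..N} \<times> {..N}" for N :: nat
  have fin: "finite (I N)" for N by (simp add: I_def)
  have small: "H i $$ k = 0" if "i \<notin> I N" "k \<le> N" for i k N
    using that supp by (cases i) (force simp: H_def I_def mono_fps_def)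
  have degree_bounded: "degree_bounded F"
    using supp by (auto simp: degree_bounded_coeff F)
  have F': "F $$ k = (\<Sum>i\<in>I N. H i $$ k)" if "k \<le> N" for k N
  proof -
    have "(\<Sum>i\<in>I N. H i $$ k) = (\<Sum>l\<le>N. \<Sum>j\<le>N. if j = k then monom (\<beta> l k) l else 0)"
      unfolding I_def sum.cartesian_product by (intro sum.cong refl)
        (auto simp: H_def mono_fps_def smult_monom)
    also have "\<dots> = (\<Sum>l\<le>N. monom (coeff (F $$ k) l) l)"
      using that by (simp add: F)
    also have "\<dots> = F $$ k"
      using degree_bounded that by (intro poly_as_sum_of_monoms') (auto simp: degree_bounded_def intro: order_trans)
    finally show ?thesis by simp
  qed
  have "vf_scale (\<beta> l k) (Emon l k) = radial (H (l, k)) \<and> ps_const (\<beta> l k) * Zmon l k = to_ps (H (l, k))" for l k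
  proof (cases "l \<le> k")
    case True
    then show ?thesis
      by (simp add: H_def Emon_eq vf_scale_radial to_ps_const_mult to_ps_mono)
  next
    case False
    then show ?thesis
      using supp[of l k] by (cases "\<beta> l k = 0") (auto simp: H_def ps_const_def vf_scale_def)
  qed
  then have eq: "(\<lambda>(l, k). vf_scale (\<beta> l k) (Emon l k)) = (\<lambda>i. radial (H i))"
       "(\<lambda>(l, k). ps_const (\<beta> l k) * Zmon l k) = (\<lambda>i. to_ps (H i))"
    by auto
  show "E_series \<beta> = radial F" "R_series \<beta> = to_ps F"
    unfolding E_series_def R_series_def eq using vf_sum_radial[of I H F, OF fin small F'] by auto
qed

definition gen_fps :: "(nat \<Rightarrow> nat \<Rightarrow> 'a::field_char_0) \<Rightarrow> 'a poly fps" where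
  "gen_fps \<beta> = Abs_fps (\<lambda>k. \<Sum>l\<le>k. monom (\<beta> l k) l)"

lemma coeff_gen_fps:
  assumes "\<And>l k. \<beta> l k \<noteq> 0 \<Longrightarrow> l \<le> k"
  shows "coeff (gen_fps \<beta> $$ k) l = \<beta> l k"
  using assms[of l k] by (auto simp: gen_fps_def coeff_sum)

lemma R_coeffs_eq: "R_coeffs = E_coeffs"
  by (force simp: R_coeffs_def E_coeffs_def)

lemma E_coeffs_supp: "\<beta> \<in> E_coeffs \<Longrightarrow> \<beta> l k \<noteq> 0 \<Longrightarrow> l \<le> k"
  by (simp add: E_coeffs_def)

lemma gen_fps_in_max_ideal:
  assumes "\<beta> \<in> E_coeffs"
  shows "gen_fps \<beta> \<in> max_ideal"
proof -
  have "\<beta> 0 0 = 0"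
    using assms unfolding E_coeffs_def mem_Collect_eq by (metis add_0 not_one_le_zero)
  then show ?thesis
    using assms by (simp add: max_ideal_def degree_bounded_coeff coeff_gen_fps E_coeffs_supp) (simp add: gen_fps_def)
qed

lemma E_series_gen_fps: "\<beta> \<in> E_coeffs \<Longrightarrow> E_series \<beta> = radial (gen_fps \<beta>)"
  and R_series_gen_fps: "\<beta> \<in> E_coeffs \<Longrightarrow> R_series \<beta> = to_ps (gen_fps \<beta>)"
  using series_eq[of \<beta> "gen_fps \<beta>"] by (simp_all add: coeff_gen_fps E_coeffs_supp)

lemma coeffs_of_max_ideal: "F \<in> max_ideal \<Longrightarrow> (\<lambda>l k. coeff (F $$ k) l) \<in> E_coeffs"
  by (force simp: max_ideal_def E_coeffs_def degree_bounded_coeff Suc_le_eq intro: ccontr)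

lemma gen_fps_coeffs: "degree_bounded F \<Longrightarrow> gen_fps (\<lambda>l k. coeff (F $$ k) l) = F"
  by (rule fps_ext, rule poly_eqI, subst coeff_gen_fps) (auto simp: degree_bounded_coeff)

lemma max_ideal_degree_bounded: "F \<in> max_ideal \<Longrightarrow> degree_bounded F"
  by (simp add: max_ideal_def)

lemma E_alg_eq: "E_alg = radial ` max_ideal"
proof
  show "E_alg \<subseteq> (radial ` max_ideal :: 'a vf set)"
    by (auto simp: E_alg_def E_series_gen_fps gen_fps_in_max_ideal)
  show "radial ` max_ideal \<subseteq> (E_alg :: 'a vf set)"
  proof (clarify)
    fix F :: "'a poly fps" assume F: "F \<in> max_ideal"
    show "radial F \<in> E_alg"
      unfolding E_alg_def using E_series_gen_fps[OF coeffs_of_max_ideal[OF F]]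
      by (intro image_eqI[OF _ coeffs_of_max_ideal[OF F]]) (simp add: gen_fps_coeffs max_ideal_degree_bounded F)
  qed
qed

lemma R_space_eq: "R_space = to_ps ` max_ideal"
proof
  show "R_space \<subseteq> (to_ps ` max_ideal :: 'a ps set)"
    by (auto simp: R_space_def R_coeffs_eq R_series_gen_fps gen_fps_in_max_ideal)
  show "to_ps ` max_ideal \<subseteq> (R_space :: 'a ps set)"
  proof (clarify)
    fix F :: "'a poly fps" assume F: "F \<in> max_ideal"
    show "to_ps F \<in> R_space"
      unfolding R_space_def R_coeffs_eq using R_series_gen_fps[OF coeffs_of_max_ideal[OF F]]
      by (intro image_eqI[OF _ coeffs_of_max_ideal[OF F]]) (simp add: gen_fps_coeffs max_ideal_degree_bounded F)
  qed
qed

text \<open>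
  The coefficients of an element of the Lie algebra are determined by it, because \<open>radial\<close> is
  injective on degree-bounded series.
\<close>

lemma E_coeff_of_radial:
  assumes "F \<in> max_ideal"
  shows "E_coeff_of (radial F) l k = coeff (F $$ k) l"
proof -
  let ?\<beta> = "E_coeff_of (radial F)"
  have "radial F \<in> E_series ` E_coeffs"
    using assms by (force simp: E_alg_eq simp flip: E_alg_def)
  then have \<beta>: "?\<beta> \<in> E_coeffs" "E_series ?\<beta> = radial F"
    unfolding E_coeff_of_def by (rule inv_into_into, rule f_inv_into_f)
  then have "gen_fps ?\<beta> = F"
    using assms by (intro radial_inject) (auto simp: E_series_gen_fps gen_fps_in_max_ideal max_ideal_degree_bounded)
  then show ?thesis
    using coeff_gen_fps[of ?\<beta> k l] \<beta>(1) E_coeffs_supp by metis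
qed

section \<open>The bracket and the order in \<open>\<rho>\<close>\<close>

text \<open>
  Unlike a bound on the subdegree, this also holds for the zero series.
\<close>

definition order_ge :: "nat \<Rightarrow> 'a::zero fps \<Rightarrow> bool" where
  "order_ge n F \<longleftrightarrow> (\<forall>k<n. F $$ k = 0)"

lemma order_ge_mono: "order_ge n F \<Longrightarrow> m \<le> n \<Longrightarrow> order_ge m F"
  by (simp add: order_ge_def)

lemma order_ge_add [intro]: "order_ge n F \<Longrightarrow> order_ge n G \<Longrightarrow> order_ge n (F + G)" for F :: "'a::comm_ring_1 fps"
  by (simp add: order_ge_def)

lemma order_ge_diff [intro]: "order_ge n F \<Longrightarrow> order_ge n G \<Longrightarrow> order_ge n (F - G)" for F :: "'a::comm_ring_1 fps"
  by (simp add: order_ge_def)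

lemma order_ge_XD [intro]: "order_ge n F \<Longrightarrow> order_ge n (fps_XD F)" for F :: "'a::comm_ring_1 fps"
  by (simp add: order_ge_def)

lemma order_ge_const_mult [intro]: "order_ge n F \<Longrightarrow> order_ge n (fps_const c * F)" for F :: "'a::comm_ring_1 fps"
  by (simp add: order_ge_def)

lemma order_ge_mult_nth:
  fixes F G :: "'a::comm_ring_1 fps"
  assumes "order_ge m F" "order_ge n G"
  shows "(F * G) $$ (m + n) = F $$ m * G $$ n"
proof -
  have "(F * G) $$ (m + n) = (\<Sum>i=0..m+n. F $$ i * G $$ (m + n - i))"
    by (rule fps_mult_nth)
  also have "\<dots> = (\<Sum>i=0..m+n. if i = m then F $$ m * G $$ n else 0)"
  proof (rule sum.cong[OF refl])
    fix i assume "i \<in> {0..m + n}"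
    then consider "i < m" | "i = m" | "m + n - i < n" by force
    then show "F $$ i * G $$ (m + n - i) = (if i = m then F $$ m * G $$ n else 0)"
      using assms by cases (auto simp: order_ge_def)
  qed
  finally show ?thesis by simp
qed

lemma order_ge_mult:
  fixes F G :: "'a::comm_ring_1 fps"
  assumes "order_ge m F" "order_ge n G"
  shows "order_ge (m + n) (F * G)"
  unfolding order_ge_def fps_mult_nth
proof (intro allI impI sum.neutral ballI)
  fix k i assume "k < m + n" "i \<in> {0..k}"
  then have "i < m \<or> k - i < n" by auto
  then show "F $$ i * G $$ (k - i) = 0"
    using assms by (auto simp: order_ge_def)
qed

lemma order_ge_mult_left: "order_ge n G \<Longrightarrow> order_ge n (F * G)" for F G :: "'a::comm_ring_1 fps"
  using order_ge_mult[of 0 F n G] by (simp add: order_ge_def)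

lemma order_ge_max_ideal: "F \<in> max_ideal \<Longrightarrow> order_ge 1 F"
  by (simp add: max_ideal_def order_ge_def)

lemma max_ideal_iff: "F \<in> max_ideal \<longleftrightarrow> degree_bounded F \<and> order_ge 1 F"
  by (simp add: max_ideal_def order_ge_def)

definition radial_bracket :: "'a::field_char_0 poly fps \<Rightarrow> 'a poly fps \<Rightarrow> 'a poly fps" where
  "radial_bracket F G = F * fps_XD G - G * fps_XD F"

lemma radial_bracket_add_right: "radial_bracket F (G + H) = radial_bracket F G + radial_bracket F H"
  by (simp add: radial_bracket_def algebra_simps)

lemma XD_diff [simp]: "fps_XD (G - H) = fps_XD G - (fps_XD H :: 'a::comm_ring_1 fps)"
  by (simp add: fps_XD_def algebra_simps)

lemma XD_mult: "fps_XD (G * H) = fps_XD G * H + G * (fps_XD H :: 'a::comm_ring_1 fps)"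
  by (simp add: fps_XD_def algebra_simps)

lemma radial_bracket_diff_right: "radial_bracket F (G - H) = radial_bracket F G - radial_bracket F H"
  by (simp add: radial_bracket_def algebra_simps)

lemma radial_bracket_diff_left: "radial_bracket (F - G) H = radial_bracket F H - radial_bracket G H"
  by (simp add: radial_bracket_def algebra_simps)

lemma radial_bracket_const_mult: "radial_bracket F (fps_const p * G) = fps_const p * radial_bracket F G"
  by (simp add: radial_bracket_def right_diff_distrib mult.assoc mult.left_commute[of F])

lemma order_ge_radial_bracket:
  assumes "order_ge m F" "order_ge n G"
  shows "order_ge (m + n) (radial_bracket F G)"
  unfolding radial_bracket_def
proof (rule order_ge_diff)
  show "order_ge (m + n) (F * fps_XD G)"
    by (rule order_ge_mult[OF assms(1) order_ge_XD[OF assms(2)]])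
  show "order_ge (m + n) (G * fps_XD F)"
    using order_ge_mult[OF assms(2) order_ge_XD[OF assms(1)]] by (simp add: add.commute)
qed

text \<open>
  The lowest coefficients multiply as in \<open>[\<rho>\<^sup>m E, \<rho>\<^sup>n E] = (n - m) \<rho>\<^sup>m\<^sup>+\<^sup>n E\<close>.
\<close>

lemma radial_bracket_nth:
  assumes "order_ge m F" "order_ge n G"
  shows "radial_bracket F G $$ (m + n) = (of_nat n - of_nat m) * (F $$ m * G $$ n)"
proof -
  have "(F * fps_XD G) $$ (m + n) = F $$ m * (of_nat n * G $$ n)"
    using order_ge_mult_nth[OF assms(1) order_ge_XD[OF assms(2)]] by simp
  moreover have "(fps_XD F * G) $$ (m + n) = of_nat m * F $$ m * G $$ n"
    using order_ge_mult_nth[OF order_ge_XD[OF assms(1)] assms(2)] by simp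
  ultimately show ?thesis
    by (simp add: radial_bracket_def mult.commute[of G "fps_XD F"]) (simp add: algebra_simps)
qed

lemma degree_bounded_radial_bracket [intro]: "degree_bounded F \<Longrightarrow> degree_bounded G \<Longrightarrow> degree_bounded (radial_bracket F G)"
  unfolding radial_bracket_def by (intro degree_bounded_diff degree_bounded_mult degree_bounded_XD)

lemma radial_bracket_max_ideal: "F \<in> max_ideal \<Longrightarrow> G \<in> max_ideal \<Longrightarrow> radial_bracket F G \<in> max_ideal"
  using order_ge_mono[OF order_ge_radial_bracket[of 1 F 1 G], of 1] by (simp add: max_ideal_iff degree_bounded_radial_bracket)

lemma lie_radial_eq_bracket: "F \<in> max_ideal \<Longrightarrow> G \<in> max_ideal \<Longrightarrow> lie (radial F) (radial G) = radial (radial_bracket F G)"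
  by (simp add: lie_radial radial_bracket_def max_ideal_degree_bounded)

section \<open>Exponentials\<close>

text \<open>
  The sum of a sequence whose n-th term has order at least n; truncating the sum at k then loses
  nothing in the coefficient of \<open>\<rho>\<^sup>k\<close>.
\<close>

definition graded_sum :: "(nat \<Rightarrow> 'a::field_char_0 poly fps) \<Rightarrow> 'a poly fps" where
  "graded_sum H = Abs_fps (\<lambda>k. \<Sum>n\<le>k. H n $$ k)"

lemma graded_sum_nth:
  assumes "\<And>n. order_ge n (H n)" "k \<le> N"
  shows "graded_sum H $$ k = (\<Sum>n\<le>N. H n) $$ k"
proof -
  have "(\<Sum>n\<le>N. H n $$ k) = (\<Sum>n\<le>k. H n $$ k)"
    using assms by (intro sum.mono_neutral_right) (auto simp: order_ge_def)
  then show ?thesis by (simp add: graded_sum_def fps_sum_nth)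
qed

lemma graded_sum_mult:
  assumes "\<And>n. order_ge n (H n)"
  shows "graded_sum (\<lambda>n. F * H n) = F * graded_sum H"
proof (rule fps_ext)
  fix k
  have "graded_sum (\<lambda>n. F * H n) $$ k = (F * (\<Sum>n\<le>k. H n)) $$ k"
    by (subst graded_sum_nth[where N = k]) (auto simp: order_ge_mult_left assms sum_distrib_left)
  also have "\<dots> = (F * graded_sum H) $$ k"
    unfolding fps_mult_nth by (intro sum.cong refl) (simp add: graded_sum_nth[OF assms, where N = k])
  finally show "graded_sum (\<lambda>n. F * H n) $$ k = (F * graded_sum H) $$ k" .
qed

lemma degree_bounded_graded_sum: "(\<And>n. degree_bounded (H n)) \<Longrightarrow> degree_bounded (graded_sum H)"
  by (auto simp: degree_bounded_def graded_sum_def intro!: degree_sum_le)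

definition radial_exp :: "'a::field_char_0 poly fps \<Rightarrow> 'a poly fps \<Rightarrow> 'a poly fps" where
  "radial_exp F G = graded_sum (\<lambda>n. fps_const [:1 / fact n:] * (radial_bracket F ^^ n) G)"

lemma order_ge_radial_bracket_pow:
  assumes "order_ge 1 F" "order_ge r G"
  shows "order_ge (r + n) ((radial_bracket F ^^ n) G)"
proof (induction n)
  case (Suc n)
  then show ?case using order_ge_radial_bracket[OF assms(1) Suc] by simp
qed (simp add: assms)

lemma degree_bounded_radial_bracket_pow: "degree_bounded F \<Longrightarrow> degree_bounded G \<Longrightarrow> degree_bounded ((radial_bracket F ^^ n) G)"
  by (induction n) auto

lemma radial_bracket_pow_max_ideal: "F \<in> max_ideal \<Longrightarrow> G \<in> max_ideal \<Longrightarrow> (radial_bracket F ^^ n) G \<in> max_ideal"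
  by (induction n) (auto simp: radial_bracket_max_ideal)

lemma radial_exp_term_ord:
  "order_ge 1 F \<Longrightarrow> order_ge r G \<Longrightarrow> order_ge (r + n) (fps_const [:1 / fact n:] * (radial_bracket F ^^ n) G)"
  by (intro order_ge_const_mult order_ge_radial_bracket_pow)

lemma radial_exp_nth:
  assumes "order_ge 1 F" "k \<le> N"
  shows "radial_exp F G $$ k = (\<Sum>n\<le>N. fps_const [:1 / fact n:] * (radial_bracket F ^^ n) G) $$ k"
  unfolding radial_exp_def using radial_exp_term_ord[OF assms(1), of 0 G]
  by (intro graded_sum_nth assms) (simp add: order_ge_def)

lemma degree_bounded_radial_exp: "degree_bounded F \<Longrightarrow> degree_bounded G \<Longrightarrow> degree_bounded (radial_exp F G)"
  unfolding radial_exp_def by (intro degree_bounded_graded_sum degree_bounded_mult degree_bounded_const degree_bounded_radial_bracket_pow)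

lemma order_ge_radial_exp: "order_ge 1 F \<Longrightarrow> order_ge r G \<Longrightarrow> order_ge r (radial_exp F G)"
  using radial_exp_term_ord[of F r G] by (auto simp: order_ge_def radial_exp_def graded_sum_def)

lemma radial_exp_max_ideal: "F \<in> max_ideal \<Longrightarrow> G \<in> max_ideal \<Longrightarrow> radial_exp F G \<in> max_ideal"
  by (simp add: max_ideal_iff degree_bounded_radial_exp order_ge_radial_exp)

lemma radial_bracket_pow_const_mult: "(radial_bracket F ^^ n) (fps_const p * G) = fps_const p * (radial_bracket F ^^ n) G"
  by (induction n) (simp_all add: radial_bracket_const_mult)

lemma radial_bracket_pow_diff: "(radial_bracket F ^^ n) (G - H) = (radial_bracket F ^^ n) G - (radial_bracket F ^^ n) H"
  by (induction n) (simp_all add: radial_bracket_diff_right)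

lemma radial_bracket_pow_add: "(radial_bracket F ^^ n) (G + H) = (radial_bracket F ^^ n) G + (radial_bracket F ^^ n) H"
  by (induction n) (simp_all add: radial_bracket_add_right)

lemma radial_exp_diff: "radial_exp F (G - H) = radial_exp F G - radial_exp F H"
  by (rule fps_ext) (simp add: radial_exp_def graded_sum_def radial_bracket_pow_diff smult_diff_right sum_subtractf)

lemma radial_exp_add: "radial_exp F (G + H) = radial_exp F G + radial_exp F H"
  by (rule fps_ext) (simp add: radial_exp_def graded_sum_def radial_bracket_pow_add smult_add_right sum.distrib)

text \<open>
  The parameter s is a constant for E, so exponentials are linear over the polynomials in s and
  not only over the field.
\<close>

lemma radial_exp_const_mult: "radial_exp F (fps_const p * G) = fps_const p * radial_exp F G"
  by (rule fps_ext) (simp add: radial_exp_def graded_sum_def radial_bracket_pow_const_mult sum_distrib_left)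

lemma radial_exp_leading:
  assumes "order_ge 1 F" "order_ge r G"
  shows "radial_exp F G $$ r = G $$ r"
proof -
  have "(fps_const [:1 / fact n:] * (radial_bracket F ^^ n) G) $$ r = (if n = 0 then G $$ r else 0)" for n
    using radial_exp_term_ord[OF assms, of n] by (auto simp: order_ge_def)
  then show ?thesis
    by (simp add: radial_exp_nth[OF assms(1) order_refl] fps_sum_nth del: fps_mult_left_const_nth)
qed

lemma radial_bracket_pow_diff_left:
  assumes "order_ge 1 F" "order_ge 1 F'" "order_ge j (F - F')" "order_ge r G"
  shows "order_ge (r + j + n) ((radial_bracket F ^^ Suc n) G - (radial_bracket F' ^^ Suc n) G)"
proof (induction n)
  case 0
  show ?case
    using order_ge_radial_bracket[OF assms(3,4)] by (simp add: radial_bracket_diff_left add.commute)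
next
  case (Suc n)
  have "(radial_bracket F ^^ Suc (Suc n)) G - (radial_bracket F' ^^ Suc (Suc n)) G =
      radial_bracket F ((radial_bracket F ^^ Suc n) G - (radial_bracket F' ^^ Suc n) G) + radial_bracket (F - F') ((radial_bracket F' ^^ Suc n) G)"
    by (simp add: radial_bracket_diff_left radial_bracket_diff_right)
  moreover have "order_ge (r + j + Suc n) (radial_bracket F ((radial_bracket F ^^ Suc n) G - (radial_bracket F' ^^ Suc n) G))"
    using order_ge_radial_bracket[OF assms(1) Suc.IH] by (simp add: ac_simps)
  moreover have "order_ge (r + j + Suc n) (radial_bracket (F - F') ((radial_bracket F' ^^ Suc n) G))"
    using order_ge_radial_bracket[OF assms(3) order_ge_radial_bracket_pow[OF assms(2,4), of "Suc n"]] by (simp add: ac_simps)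
  ultimately show ?case by (simp only: order_ge_add)
qed

text \<open>
  A perturbation of F of order j affects the exponential at the lowest order only through the
  linear term \<open>[F - F', G]\<close>. This governs both the recursion for the normalizing transformation
  and the distinction of symmetries.
\<close>

lemma radial_exp_diff_left:
  assumes "order_ge 1 F" "order_ge 1 F'" "order_ge j (F - F')" "order_ge r G"
  shows "order_ge (r + j) (radial_exp F G - radial_exp F' G)"
    and "(radial_exp F G - radial_exp F' G) $$ (r + j) = (of_nat r - of_nat j) * ((F - F') $$ j * G $$ r)"
proof -
  define D where "D n = fps_const [:1 / fact n:] * ((radial_bracket F ^^ n) G - (radial_bracket F' ^^ n) G)" for n
  have nth: "(radial_exp F G - radial_exp F' G) $$ k = (\<Sum>n\<le>Suc k. D n $$ k)" for k
    using radial_exp_nth[OF assms(1), of k "Suc k" G] radial_exp_nth[OF assms(2), of k "Suc k" G]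
    by (simp add: D_def fps_sum_nth smult_diff_right sum_subtractf)
  have D0: "D 0 = 0" by (simp add: D_def)
  have D: "order_ge (r + j + n) (D (Suc n))" for n
    unfolding D_def by (intro order_ge_const_mult radial_bracket_pow_diff_left assms)
  show "order_ge (r + j) (radial_exp F G - radial_exp F' G)"
    unfolding order_ge_def nth
  proof (intro allI impI sum.neutral ballI)
    fix k n assume "k < r + j" "n \<in> {..Suc k}"
    then show "D n $$ k = 0" using D[of "n - 1"] D0 by (cases n) (auto simp: order_ge_def)
  qed
  have "(radial_exp F G - radial_exp F' G) $$ (r + j) = (\<Sum>n\<le>Suc (r + j). if n = 1 then radial_bracket (F - F') G $$ (r + j) else 0)"
    unfolding nth
  proof (rule sum.cong[OF refl])
    fix n assume "n \<in> {..Suc (r + j)}"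
    consider "n = 0" | "n = 1" | m where "n = Suc (Suc m)" by (metis One_nat_def not0_implies_Suc)
    then show "D n $$ (r + j) = (if n = 1 then radial_bracket (F - F') G $$ (r + j) else 0)"
    proof cases
      case 3 then show ?thesis using D[of "Suc m"] by (simp add: order_ge_def)
    qed (simp_all add: D_def radial_bracket_diff_left)
  qed
  also have "\<dots> = radial_bracket (F - F') G $$ (j + r)"
    by (simp add: add.commute)
  also have "\<dots> = (of_nat r - of_nat j) * ((F - F') $$ j * G $$ r)"
    by (rule radial_bracket_nth[OF assms(3,4)])
  finally show "(radial_exp F G - radial_exp F' G) $$ (r + j) = (of_nat r - of_nat j) * ((F - F') $$ j * G $$ r)" .
qed

lemma exp_ad_radial:
  assumes "F \<in> max_ideal" "G \<in> max_ideal"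
  shows "exp_ad (radial F) (radial G) = radial (radial_exp F G)"
proof -
  have "(lie (radial F) ^^ n) (radial G) = radial ((radial_bracket F ^^ n) G)" for n
    by (induction n) (simp_all add: lie_radial_eq_bracket radial_bracket_pow_max_ideal assms)
  then have "exp_ad (radial F) (radial G) = vf_sum (\<lambda>n. radial (fps_const [:1 / fact n:] * (radial_bracket F ^^ n) G))"
    by (simp add: exp_ad_def vf_scale_radial)
  also have "\<dots> = radial (radial_exp F G)"
  proof (rule vf_sum_radial(1)[where I = "\<lambda>N. {..N}"])
    fix N n k :: nat assume "n \<notin> {..N}" "k \<le> N"
    then show "(fps_const [:1 / fact n:] * (radial_bracket F ^^ n) G) $$ k = 0"
      using radial_exp_term_ord[OF order_ge_max_ideal[OF assms(1)], of 0 G n] by (simp add: order_ge_def)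
  qed (simp_all add: radial_exp_nth[OF order_ge_max_ideal[OF assms(1)]] fps_sum_nth)
  finally show ?thesis .
qed

section \<open>Triangular maps and permissible transformations\<close>

text \<open>
  Coefficient-by-coefficient construction: the k-th condition involves the coefficients up to k,
  and can be met by the choice of the k-th one.
\<close>

lemma exists_fps_by_truncation:
  fixes P :: "nat \<Rightarrow> 'a::comm_ring_1 fps \<Rightarrow> bool"
  assumes "\<And>k F. (\<And>i. i < k \<Longrightarrow> P i (fps_cutoff (Suc i) F)) \<Longrightarrow>
             \<exists>c. P k (fps_cutoff k F + fps_const c * fps_X ^ k)"
  shows "\<exists>F. \<forall>k. P k (fps_cutoff (Suc k) F)"
proof -
  define Q where "Q f k c = P k (fps_cutoff k (Abs_fps f) + fps_const c * fps_X ^ k)"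
    for f :: "nat \<Rightarrow> 'a" and k and c :: 'a
  have step: "fps_cutoff k (Abs_fps f) + fps_const (f k) * fps_X ^ k = fps_cutoff (Suc k) (Abs_fps f)"
    for f :: "nat \<Rightarrow> 'a" and k
    by (auto simp: fps_eq_iff less_Suc_eq)
  have "\<exists>f. \<forall>k. Q f k (f k)"
  proof (rule dependent_wellorder_choice)
    fix c and f g :: "nat \<Rightarrow> 'a" and k :: nat assume "\<And>i. i < k \<Longrightarrow> f i = g i"
    then have "fps_cutoff k (Abs_fps f) = fps_cutoff k (Abs_fps g)"
      by (simp add: fps_eq_iff)
    then show "Q f k c = Q g k c" by (simp add: Q_def)
  next
    fix k and f :: "nat \<Rightarrow> 'a" assume "\<And>i. i < k \<Longrightarrow> Q f i (f i)"
    then show "\<exists>c. Q f k c"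
      unfolding Q_def step by (intro assms) auto
  qed
  then show ?thesis unfolding Q_def step by blast
qed

lemma max_ideal_cutoff:
  assumes "\<And>i. i < k \<Longrightarrow> degree (F $$ i) \<le> i" "k > 0 \<Longrightarrow> F $$ 0 = 0"
  shows "fps_cutoff k F \<in> max_ideal"
  using assms by (simp add: max_ideal_def degree_bounded_def)

lemma max_ideal_diff: "F \<in> max_ideal \<Longrightarrow> G \<in> max_ideal \<Longrightarrow> F - G \<in> max_ideal"
  by (auto simp: max_ideal_def)

lemma max_ideal_add: "F \<in> max_ideal \<Longrightarrow> G \<in> max_ideal \<Longrightarrow> F + G \<in> max_ideal"
  by (auto simp: max_ideal_def)

lemma max_ideal_mult: "degree_bounded F \<Longrightarrow> G \<in> max_ideal \<Longrightarrow> F * G \<in> max_ideal"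
  by (auto simp: max_ideal_def)

lemma one_plus_mult_max_ideal: "T \<in> max_ideal \<Longrightarrow> F \<in> max_ideal \<Longrightarrow> (1 + T) * F \<in> max_ideal"
  by (intro max_ideal_mult degree_bounded_add degree_bounded_one max_ideal_degree_bounded)

lemma max_ideal_XD: "F \<in> max_ideal \<Longrightarrow> fps_XD F \<in> max_ideal"
  by (auto simp: max_ideal_def)

lemma max_ideal_monomial: "degree c \<le> k \<Longrightarrow> k > 0 \<Longrightarrow> fps_const c * fps_X ^ k \<in> max_ideal"
  by (simp add: max_ideal_def degree_bounded_def)

lemma radial_in_E_alg: "F \<in> max_ideal \<Longrightarrow> radial F \<in> E_alg"
  by (simp add: E_alg_eq)

lemma to_ps_in_R_space: "F \<in> max_ideal \<Longrightarrow> to_ps F \<in> R_space"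
  by (simp add: R_space_eq)

text \<open>
  A map that changes each coefficient only by lower ones can be inverted recursively. Both kinds
  of generators of the permissible group are of this form, so they are bijections of the Lie
  algebra.
\<close>

lemma bij_betw_triangular:
  fixes L :: "'a::field_char_0 poly fps \<Rightarrow> 'a poly fps"
  assumes maps: "\<And>F. F \<in> max_ideal \<Longrightarrow> L F \<in> max_ideal"
    and tri: "\<And>F G k. F \<in> max_ideal \<Longrightarrow> G \<in> max_ideal \<Longrightarrow> order_ge k (F - G) \<Longrightarrow> (L F - L G) $$ k = (F - G) $$ k"
  shows "bij_betw L max_ideal max_ideal"
  unfolding bij_betw_def
proof
  show "inj_on L max_ideal"
  proof (rule inj_onI)
    fix F G assume *: "F \<in> max_ideal" "G \<in> max_ideal" "L F = L G"
    have "(F - G) $$ k = 0" for k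
    proof (induction k rule: less_induct)
      case (less k)
      then show ?case using tri[OF *(1,2), of k] *(3) by (simp add: order_ge_def)
    qed
    then show "F = G" by (simp add: fps_eq_iff)
  qed
  show "L ` max_ideal = max_ideal"
  proof
    show "max_ideal \<subseteq> L ` max_ideal"
    proof
      fix H :: "'a poly fps" assume H: "H \<in> max_ideal"
      define P where "P k F \<longleftrightarrow> degree (F $$ k) \<le> k \<and> (k = 0 \<longrightarrow> F $$ 0 = 0) \<and> L F $$ k = H $$ k"
        for k and F :: "'a poly fps"
      have "\<exists>c. P k (fps_cutoff k F + fps_const c * fps_X ^ k)"
        if F: "\<And>i. i < k \<Longrightarrow> P i (fps_cutoff (Suc i) F)" for k F
      proof -
        define F0 where "F0 = fps_cutoff k F"
        define c where "c = (H - L F0) $$ k"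
        define F1 where "F1 = F0 + fps_const c * fps_X ^ k"
        have F0: "F0 \<in> max_ideal"
          unfolding F0_def using F by (intro max_ideal_cutoff) (auto simp: P_def)
        then have HL: "H - L F0 \<in> max_ideal" using H maps max_ideal_diff by blast
        then have c: "degree c \<le> k" "k = 0 \<Longrightarrow> c = 0"
          by (auto simp: c_def max_ideal_def degree_bounded_def)
        then have "fps_const c * fps_X ^ k \<in> max_ideal"
          by (cases "k = 0") (simp_all add: max_ideal_monomial, simp add: max_ideal_def)
        then have F1: "F1 \<in> max_ideal" unfolding F1_def by (rule max_ideal_add[OF F0])
        have diff: "F1 - F0 = fps_const c * fps_X ^ k" by (simp add: F1_def)
        have "(L F1 - L F0) $$ k = (F1 - F0) $$ k"
          by (rule tri[OF F1 F0]) (simp add: diff order_ge_def)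
        then have "L F1 $$ k = H $$ k" by (simp add: diff c_def)
        moreover have "F1 $$ k = c" by (simp add: F1_def F0_def)
        ultimately have "P k F1" using c by (auto simp: P_def)
        then show ?thesis unfolding F1_def F0_def by blast
      qed
      from exists_fps_by_truncation[of P, OF this]
      obtain F where F: "P k (fps_cutoff (Suc k) F)" for k by blast
      have cut: "fps_cutoff (Suc k) F \<in> max_ideal" for k
        using F by (intro max_ideal_cutoff) (auto simp: P_def)
      have FM: "F \<in> max_ideal"
        using F by (auto simp: P_def max_ideal_def degree_bounded_def)
      have "L F $$ k = H $$ k" for k
      proof -
        have "(L F - L (fps_cutoff (Suc k) F)) $$ k = (F - fps_cutoff (Suc k) F) $$ k"
          by (rule tri[OF FM cut]) (simp add: order_ge_def)
        then show ?thesis using F[of k] by (simp add: P_def)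
      qed
      then have "H = L F" by (simp add: fps_eq_iff)
      then show "H \<in> L ` max_ideal" using FM by blast
    qed
  qed (use maps in blast)
qed

lemma bij_betw_radial_exp:
  assumes "S \<in> max_ideal"
  shows "bij_betw (radial_exp S) max_ideal max_ideal"
proof (rule bij_betw_triangular)
  fix F G :: "'a poly fps" and k assume "order_ge k (F - G)"
  then show "(radial_exp S F - radial_exp S G) $$ k = (F - G) $$ k"
    using radial_exp_leading[OF order_ge_max_ideal[OF assms]] by (metis radial_exp_diff)
qed (simp add: radial_exp_max_ideal assms)

lemma bij_betw_scaling:
  assumes "T \<in> max_ideal"
  shows "bij_betw (\<lambda>F. (1 + T) * F) max_ideal max_ideal"
proof (rule bij_betw_triangular)
  fix F G :: "'a poly fps" and k assume *: "F \<in> max_ideal" "G \<in> max_ideal" "order_ge k (F - G)"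
  have "((1 + T) * F - (1 + T) * G) $$ (0 + k) = (1 + T) $$ 0 * (F - G) $$ k"
    using order_ge_mult_nth[of 0 "1 + T" k "F - G"] * by (simp add: order_ge_def right_diff_distrib)
  then show "((1 + T) * F - (1 + T) * G) $$ k = (F - G) $$ k"
    using assms by (simp add: max_ideal_def)
qed (rule one_plus_mult_max_ideal[OF assms])

lemma restrict_in_Bij:
  assumes act: "\<And>F. F \<in> max_ideal \<Longrightarrow> f (radial F) = radial (L F)" and L: "bij_betw L max_ideal max_ideal"
  shows "restrict f E_alg \<in> Bij E_alg"
proof -
  have "inj_on f E_alg"
  proof (rule inj_onI)
    fix u v assume "u \<in> E_alg" "v \<in> E_alg" "f u = f v"
    then obtain F G where FG: "F \<in> max_ideal" "G \<in> max_ideal" "u = radial F" "v = radial G" "radial (L F) = radial (L G)"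
      by (auto simp: E_alg_eq act)
    moreover have "L F \<in> max_ideal" "L G \<in> max_ideal"
      using L FG by (auto simp: bij_betw_def)
    ultimately have "L F = L G" using radial_inject max_ideal_degree_bounded by blast
    then show "u = v" using FG L by (auto simp: bij_betw_def dest: inj_onD)
  qed
  moreover have "f ` E_alg = E_alg"
  proof -
    have "f ` E_alg = radial ` (L ` max_ideal)"
      by (auto simp: E_alg_eq image_image act)
    also have "L ` max_ideal = max_ideal" using L by (simp add: bij_betw_def)
    finally show ?thesis by (simp add: E_alg_eq)
  qed
  ultimately have "bij_betw f E_alg E_alg" by (simp add: bij_betw_def)
  then have "bij_betw (restrict f E_alg) E_alg E_alg"
    by (subst bij_betw_cong[of E_alg _ f]) auto
  then show ?thesis by (simp add: Bij_def)
qed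

lemma one_plus_to_ps_scale_radial:
  "T \<in> max_ideal \<Longrightarrow> F \<in> max_ideal \<Longrightarrow> (1 + to_ps T) *s radial F = radial ((1 + T) * F)"
  using to_ps_scale_radial[of T F]
  by (simp add: max_ideal_degree_bounded radial_add vec_eq_iff distrib_right)

lemma permissible_generators:
  "{restrict (exp_ad S) E_alg | S. S \<in> E_alg} \<union>
      {restrict (\<lambda>u. (1 + T) *s u) E_alg | T. T \<in> R_space} \<subseteq> Bij (E_alg :: 'a::field_char_0 vf set)"
proof -
  have "restrict (exp_ad S) E_alg \<in> Bij E_alg" if "S \<in> E_alg" for S :: "'a vf"
  proof -
    obtain F where "F \<in> max_ideal" "S = radial F" using \<open>S \<in> E_alg\<close> by (auto simp: E_alg_eq)
    then show ?thesis by (intro restrict_in_Bij[of _ "radial_exp F"]) (simp_all add: exp_ad_radial bij_betw_radial_exp)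
  qed
  moreover have "restrict (\<lambda>u. (1 + T) *s u) E_alg \<in> Bij E_alg" if "T \<in> R_space" for T :: "'a ps"
  proof -
    obtain F where "F \<in> max_ideal" "T = to_ps F" using \<open>T \<in> R_space\<close> by (auto simp: R_space_eq)
    then show ?thesis
      by (intro restrict_in_Bij[of _ "\<lambda>G. (1 + F) * G"]) (simp_all add: one_plus_to_ps_scale_radial bij_betw_scaling)
  qed
  ultimately show ?thesis by blast
qed

text \<open>
  The product of \<open>BijGroup\<close> is only specified on bijections, so composing permissible maps
  relies on this.
\<close>

lemma permissible_Bij: "g \<in> permissible \<Longrightarrow> g \<in> Bij E_alg"
  using group.generate_in_carrier[OF group_BijGroup[of E_alg], of _ g] permissible_generators
  unfolding permissible_def by (simp only: BijGroup_def partial_object.simps)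

lemma permissible_compose:
  assumes "g \<in> permissible" "h \<in> permissible"
  shows "compose E_alg g h \<in> permissible"
proof -
  have "g \<otimes>\<^bsub>BijGroup E_alg\<^esub> h \<in> permissible"
    using assms unfolding permissible_def by (rule generate.eng)
  then show ?thesis
    using assms[THEN permissible_Bij] by (simp add: BijGroup_def)
qed

lemma permissible_inverse:
  assumes "g \<in> permissible" "u \<in> E_alg"
  shows "\<exists>h\<in>permissible. h (g u) = u"
proof
  let ?h = "inv\<^bsub>BijGroup E_alg\<^esub> g"
  have g: "g \<in> Bij E_alg" by (rule permissible_Bij[OF assms(1)])
  show "?h \<in> permissible"
    using assms(1) permissible_generators unfolding permissible_def
    by (intro group.generate_m_inv_closed[OF group_BijGroup]) (simp_all add: BijGroup_def)
  have "g u \<in> E_alg" using g assms(2) by (auto simp: Bij_def bij_betw_def)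
  then show "?h (g u) = u"
    using g assms(2) bij_betw_inv_into_left[of g E_alg E_alg u]
    by (simp add: inv_BijGroup) (simp add: Bij_def)
qed

lemma permissible_exp: "S \<in> max_ideal \<Longrightarrow> restrict (exp_ad (radial S)) E_alg \<in> permissible"
  unfolding permissible_def by (rule generate.incl, rule UnI1) (blast intro: radial_in_E_alg)

lemma permissible_scaling: "T \<in> max_ideal \<Longrightarrow> restrict (\<lambda>u. (1 + to_ps T) *s u) E_alg \<in> permissible"
  unfolding permissible_def by (rule generate.incl, rule UnI2) (blast intro: to_ps_in_R_space)

definition orbit_equiv :: "'a::field_char_0 poly fps \<Rightarrow> 'a poly fps \<Rightarrow> bool" where
  "orbit_equiv F G \<longleftrightarrow> F \<in> max_ideal \<and> G \<in> max_ideal \<and> (\<exists>g\<in>permissible. g (radial F) = radial G)"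

lemma orbit_equiv_trans [trans]:
  assumes "orbit_equiv F G" "orbit_equiv G H"
  shows "orbit_equiv F H"
proof -
  obtain g h where "g \<in> permissible" "h \<in> permissible" "g (radial F) = radial G" "h (radial G) = radial H"
    using assms by (auto simp: orbit_equiv_def)
  moreover have "F \<in> max_ideal" "H \<in> max_ideal" using assms by (auto simp: orbit_equiv_def)
  ultimately show ?thesis
    using permissible_compose[of h g] unfolding orbit_equiv_def
    by (intro conjI bexI[of _ "compose E_alg h g"]) (simp_all add: compose_def radial_in_E_alg)
qed

lemma orbit_equiv_sym:
  assumes "orbit_equiv F G"
  shows "orbit_equiv G F"
proof -
  obtain g where "g \<in> permissible" "g (radial F) = radial G" and FG: "F \<in> max_ideal" "G \<in> max_ideal"
    using assms by (auto simp: orbit_equiv_def)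
  then show ?thesis
    using permissible_inverse[of g "radial F"] radial_in_E_alg[of F] by (simp add: orbit_equiv_def)
qed

lemma orbit_equiv_exp: "S \<in> max_ideal \<Longrightarrow> F \<in> max_ideal \<Longrightarrow> orbit_equiv F (radial_exp S F)"
  unfolding orbit_equiv_def
  by (intro conjI bexI[OF _ permissible_exp[of S]]) (simp_all add: exp_ad_radial radial_exp_max_ideal radial_in_E_alg)

lemma orbit_equiv_scaling: "T \<in> max_ideal \<Longrightarrow> F \<in> max_ideal \<Longrightarrow> orbit_equiv F ((1 + T) * F)"
  unfolding orbit_equiv_def
  by (intro conjI bexI[OF _ permissible_scaling[of T]])
     (simp_all add: one_plus_to_ps_scale_radial radial_in_E_alg one_plus_mult_max_ideal)

section \<open>Orbital normalization\<close>

text \<open>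
  Raising T by \<open>c \<rho>\<^sup>k\<close> adds \<open>(s + b) c\<close> to the coefficient of \<open>\<rho>\<^sup>k\<^sup>+\<^sup>1\<close>. Division with remainder
  by \<open>s + b\<close> therefore removes everything but a constant from each coefficient in turn, and the
  quotient respects the degree bound.
\<close>

lemma weierstrass_preparation:
  fixes F :: "'a::field_char_0 poly fps"
  assumes F: "F \<in> max_ideal" and F1: "F $$ Suc 0 = [:b, 1:]"
  obtains T where "T \<in> max_ideal" "\<And>k. k \<ge> 2 \<Longrightarrow> degree (((1 + T) * F) $$ k) = 0"
proof -
  define P where "P k T \<longleftrightarrow> degree (T $$ k) \<le> k \<and> (k = 0 \<longrightarrow> T $$ 0 = 0) \<and>
      (k > 0 \<longrightarrow> degree (((1 + T) * F) $$ Suc k) = 0)" for k and T :: "'a poly fps"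
  have "\<exists>c. P k (fps_cutoff k T + fps_const c * fps_X ^ k)"
    if T: "\<And>i. i < k \<Longrightarrow> P i (fps_cutoff (Suc i) T)" for k T
  proof (cases "k = 0")
    case True
    then show ?thesis by (intro exI[of _ 0]) (simp add: P_def)
  next
    case False
    define T0 where "T0 = fps_cutoff k T"
    define R where "R = ((1 + T0) * F) $$ Suc k"
    \<comment> \<open>the negative of the quotient of R by \<open>s + b\<close>\<close>
    define c where "c = - synthetic_div R (- b)"
    define T1 where "T1 = T0 + fps_const c * fps_X ^ k"
    have T0: "T0 \<in> max_ideal"
      unfolding T0_def using T by (intro max_ideal_cutoff) (auto simp: P_def)
    then have "degree_bounded ((1 + T0) * F)" using F one_plus_mult_max_ideal max_ideal_degree_bounded by blast
    then have "degree R \<le> Suc k" by (simp add: degree_bounded_def R_def)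
    then have c: "degree c \<le> k" by (simp add: c_def degree_synthetic_div)
    have ord: "order_ge k (fps_const c * fps_X ^ k)" by (simp add: order_ge_def)
    have "((1 + T1) * F) $$ Suc k = R + ((fps_const c * fps_X ^ k) * F) $$ (k + 1)"
      by (simp add: T1_def R_def distrib_right)
    also have "\<dots> = R + c * [:b, 1:]"
      by (subst order_ge_mult_nth[OF ord order_ge_max_ideal[OF F]]) (simp add: F1)
    also have "\<dots> = [:poly R (- b):]"
    proof -
      have "[:b, 1:] * synthetic_div R (- b) + [:poly R (- b):] = R"
        using synthetic_div_correct'[of "- b" R] by simp
      then have "R = [:b, 1:] * synthetic_div R (- b) + [:poly R (- b):]" by (rule sym)
      then show ?thesis unfolding c_def minus_mult_left[symmetric] by (metis add_diff_cancel_left' mult.commute uminus_add_conv_diff add.commute)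
    qed
    finally have "degree (((1 + T1) * F) $$ Suc k) = 0" by simp
    moreover have "T1 $$ k = c" by (simp add: T1_def T0_def)
    ultimately have "P k T1" using c False by (simp add: P_def)
    then show ?thesis unfolding T1_def T0_def by blast
  qed
  from exists_fps_by_truncation[of P, OF this]
  obtain T where T: "P k (fps_cutoff (Suc k) T)" for k by blast
  show ?thesis
  proof
    show "T \<in> max_ideal" using T by (auto simp: P_def max_ideal_def degree_bounded_def)
    fix k :: nat assume "k \<ge> 2"
    then obtain j where j: "k = Suc j" "j > 0" by (cases k) auto
    have "((1 + T) * F) $$ k = ((1 + fps_cutoff (Suc j) T) * F) $$ k"
      unfolding fps_mult_nth
    proof (rule sum.cong[OF refl])
      fix i assume "i \<in> {0..k}"
      then consider "i = k" | "i \<le> j" using j by fastforce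
      then show "(1 + T) $$ i * F $$ (k - i) = (1 + fps_cutoff (Suc j) T) $$ i * F $$ (k - i)"
        using F by cases (auto simp: max_ideal_def)
    qed
    then show "degree (((1 + T) * F) $$ k) = 0"
      using T[of j] j by (simp add: P_def)
  qed
qed

text \<open>
  Independence of s: the series lies in \<open>F[[\<rho>]]\<close>.
\<close>

definition const_coeffs :: "'a::field_char_0 poly fps \<Rightarrow> bool" where
  "const_coeffs F \<longleftrightarrow> (\<forall>k. degree (F $$ k) = 0)"

lemma const_coeffs_diff: "const_coeffs F \<Longrightarrow> const_coeffs G \<Longrightarrow> const_coeffs (F - G)"
  unfolding const_coeffs_def by (metis degree_diff_le fps_sub_nth le_zero_eq)

lemma degree_of_nat_mult: "degree (of_nat k * p) \<le> degree p" for p :: "'a::field_char_0 poly"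
  by (simp add: of_nat_poly)

lemma const_coeffs_XD: "const_coeffs F \<Longrightarrow> const_coeffs (fps_XD F)"
  unfolding const_coeffs_def by (metis degree_of_nat_mult fps_XD_nth le_zero_eq)

lemma const_coeffs_mult:
  assumes "const_coeffs F" "const_coeffs G" shows "const_coeffs (F * G)"
  unfolding const_coeffs_def fps_mult_nth
proof
  fix k
  have "degree (F $$ i * G $$ (k - i)) \<le> 0" for i
    using degree_mult_le[of "F $$ i" "G $$ (k - i)"] assms by (simp add: const_coeffs_def)
  then have "degree (\<Sum>i = 0..k. F $$ i * G $$ (k - i)) \<le> 0"
    by (intro degree_sum_le) auto
  then show "degree (\<Sum>i = 0..k. F $$ i * G $$ (k - i)) = 0" by simp
qed

lemma const_coeffs_const: "const_coeffs (fps_const [:c:])"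
  by (simp add: const_coeffs_def)

lemma const_coeffs_X_power: "const_coeffs (fps_X ^ n)"
  by (simp add: const_coeffs_def)

lemma const_coeffs_radial_exp:
  assumes "const_coeffs F" "const_coeffs G" shows "const_coeffs (radial_exp F G)"
proof -
  have "const_coeffs ((radial_bracket F ^^ n) G)" for n
    by (induction n) (simp_all add: assms radial_bracket_def const_coeffs_diff const_coeffs_mult const_coeffs_XD)
  then have "const_coeffs (fps_const [:1 / fact n:] * (radial_bracket F ^^ n) G)" for n
    by (intro const_coeffs_mult const_coeffs_const)
  then have "degree (radial_exp F G $$ k) \<le> 0" for k
    unfolding radial_exp_def graded_sum_def fps_nth_Abs_fps
    by (intro degree_sum_le) (simp_all add: const_coeffs_def del: fps_mult_left_const_nth)
  then show ?thesis by (simp add: const_coeffs_def)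
qed

lemma const_coeffs_max_ideal: "const_coeffs F \<Longrightarrow> F $$ 0 = 0 \<Longrightarrow> F \<in> max_ideal"
  by (simp add: const_coeffs_def max_ideal_def degree_bounded_def)

text \<open>
  The factor in front of E in \<open>E\<^sup>1\<^sub>1 + b E\<^sup>0\<^sub>1 + c E\<^sup>0\<^sub>r\<close>, namely \<open>(s + b) \<rho> + c \<rho>\<^sup>r\<close>.
\<close>

definition nf_series :: "nat \<Rightarrow> 'a::field_char_0 \<Rightarrow> 'a \<Rightarrow> 'a poly fps" where
  "nf_series r b c = fps_const [:b, 1:] * fps_X + fps_const [:c:] * fps_X ^ r"

text \<open>
  Writing \<open>w = exp(ad) \<rho>\<close> for the image of \<open>\<rho>\<close>, the condition says that the function \<open>G / \<rho>\<close>
  becomes the monomial \<open>a \<rho>\<^sup>r\<^sup>-\<^sup>1\<close> in the new coordinate, without a condition on the factor w. A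
  term \<open>t \<rho>\<^sup>j\<close> of \<open>\<psi>\<close> changes the left side at \<open>\<rho>\<^sup>r\<^sup>+\<^sup>j\<close> by \<open>(r - j) a t\<close> and the right side by
  \<open>(1 - j) a t\<close>; the difference \<open>(r - 1) a t\<close> is independent of j and nonzero, so \<open>\<psi>\<close> is found
  recursively.
\<close>

lemma straighten_to_monomial:
  fixes G :: "'a::field_char_0 poly fps"
  assumes G: "const_coeffs G" "order_ge r G" "G $$ r = [:a:]" and a: "a \<noteq> 0" and r: "r \<ge> 2"
  obtains \<psi> where "const_coeffs \<psi>" "\<psi> \<in> max_ideal" "radial_exp \<psi> G = fps_const [:a:] * fps_X ^ (r - 1) * radial_exp \<psi> fps_X"
proof -
  define X where "X = (fps_X :: 'a poly fps)"
  define C where "C = fps_const [:a:] * (fps_X ^ (r - 1) :: 'a poly fps)"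
  define D where "D \<psi> = radial_exp \<psi> G - C * radial_exp \<psi> X" for \<psi>
  define P where "P j \<psi> \<longleftrightarrow> degree (\<psi> $$ j) = 0 \<and> (j = 0 \<longrightarrow> \<psi> $$ 0 = 0) \<and> (j > 0 \<longrightarrow> D \<psi> $$ (r + j) = 0)"
    for j \<psi>
  have X: "const_coeffs X" "order_ge 1 X" "X $$ 1 = 1"
    by (simp_all add: X_def const_coeffs_def fps_X_def order_ge_def)
  have C: "const_coeffs C" "order_ge (r - 1) C" "C $$ (r - 1) = [:a:]"
    by (simp_all add: C_def const_coeffs_const const_coeffs_mult const_coeffs_X_power order_ge_def)
  have diff: "(D \<psi>' - D \<psi>) $$ (r + j) = (of_nat r - 1) * [:a:] * (\<psi>' - \<psi>) $$ j"
    if "\<psi> $$ 0 = 0" "\<psi>' $$ 0 = 0" "order_ge j (\<psi>' - \<psi>)" for \<psi> \<psi>' j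
  proof -
    have o: "order_ge 1 \<psi>" "order_ge 1 \<psi>'" using that by (auto simp: order_ge_def)
    have shift: "(r - 1) + (1 + j) = r + j" using r by simp
    have 1: "(radial_exp \<psi>' G - radial_exp \<psi> G) $$ (r + j) = (of_nat r - of_nat j) * ((\<psi>' - \<psi>) $$ j * [:a:])"
      using radial_exp_diff_left(2)[OF o(2,1) that(3) G(2)] by (simp only: G(3))
    have "(radial_exp \<psi>' X - radial_exp \<psi> X) $$ (1 + j) = (1 - of_nat j) * (\<psi>' - \<psi>) $$ j"
      using radial_exp_diff_left(2)[OF o(2,1) that(3) X(2)] by (simp only: X(3) mult_1_right of_nat_1)
    then have 2: "(C * (radial_exp \<psi>' X - radial_exp \<psi> X)) $$ (r + j) = [:a:] * ((1 - of_nat j) * (\<psi>' - \<psi>) $$ j)"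
      using order_ge_mult_nth[OF C(2) radial_exp_diff_left(1)[OF o(2,1) that(3) X(2)]]
      unfolding shift C(3) by (simp only:)
    have "D \<psi>' - D \<psi> = (radial_exp \<psi>' G - radial_exp \<psi> G) - C * (radial_exp \<psi>' X - radial_exp \<psi> X)"
      by (simp add: D_def algebra_simps)
    then have "(D \<psi>' - D \<psi>) $$ (r + j) =
        (radial_exp \<psi>' G - radial_exp \<psi> G) $$ (r + j) - (C * (radial_exp \<psi>' X - radial_exp \<psi> X)) $$ (r + j)"
      by (simp only: fps_sub_nth)
    also have "\<dots> = (of_nat r - of_nat j) * ((\<psi>' - \<psi>) $$ j * [:a:]) - [:a:] * ((1 - of_nat j) * (\<psi>' - \<psi>) $$ j)"
      unfolding 1 2 ..
    also have "\<dots> = (of_nat r - 1) * [:a:] * (\<psi>' - \<psi>) $$ j"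
    proof -
      have "(x - y) * (z * p) - p * ((1 - y) * z) = (x - 1) * p * z" for x y z p :: "'a poly"
        by (simp add: algebra_simps)
      then show ?thesis .
    qed
    finally show ?thesis .
  qed
  have "\<exists>c. P j (fps_cutoff j \<psi> + fps_const c * fps_X ^ j)"
    if \<psi>: "\<And>i. i < j \<Longrightarrow> P i (fps_cutoff (Suc i) \<psi>)" for j \<psi>
  proof (cases "j = 0")
    case True
    then show ?thesis by (intro exI[of _ 0]) (simp add: P_def)
  next
    case False
    define \<psi>0 where "\<psi>0 = fps_cutoff j \<psi>"
    define e where "e = coeff (D \<psi>0 $$ (r + j)) 0"
    \<comment> \<open>the coefficient that cancels the error e, by the difference formula above\<close>
    define c where "c = - e / ((of_nat r - 1) * a)"
    define \<psi>1 where "\<psi>1 = \<psi>0 + fps_const [:c:] * fps_X ^ j"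
    have z: "\<psi>0 $$ 0 = 0" "\<psi>1 $$ 0 = 0"
      using \<psi>[of 0] False by (auto simp: P_def \<psi>0_def \<psi>1_def)
    have "const_coeffs \<psi>0"
      using \<psi> by (auto simp: P_def \<psi>0_def const_coeffs_def)
    then have "const_coeffs (D \<psi>0)"
      unfolding D_def by (intro const_coeffs_diff const_coeffs_mult const_coeffs_radial_exp G X C)
    then have e: "D \<psi>0 $$ (r + j) = [:e:]"
      unfolding const_coeffs_def e_def by (metis degree_0_id)
    have d: "\<psi>1 - \<psi>0 = fps_const [:c:] * fps_X ^ j" by (simp add: \<psi>1_def)
    have "(D \<psi>1 - D \<psi>0) $$ (r + j) = (of_nat r - 1) * [:a:] * [:c:]"
      by (subst diff[OF z]) (simp_all add: d order_ge_def)
    also have "(of_nat r - 1) * [:a:] * [:c:] = [:- e:]"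
    proof -
      have "of_nat r \<noteq> (of_nat 1 :: 'a)" using r unfolding of_nat_eq_iff by simp
      then have "(of_nat r - 1 :: 'a) \<noteq> 0" by simp
      then have "(of_nat r - 1) * a * c = - e" using a by (simp add: c_def)
      moreover have "(of_nat r - 1 :: 'a poly) = [:of_nat r - 1:]" by (simp add: of_nat_poly one_pCons)
      ultimately show ?thesis by (simp add: ac_simps)
    qed
    finally have "D \<psi>1 $$ (r + j) = 0" unfolding fps_sub_nth e by (simp add: eq_diff_eq[symmetric] diff_eq_eq)
    moreover have "\<psi>1 $$ j = [:c:]" by (simp add: \<psi>1_def \<psi>0_def)
    ultimately have "P j \<psi>1" using z False by (simp add: P_def)
    then show ?thesis unfolding \<psi>1_def \<psi>0_def by blast
  qed
  from exists_fps_by_truncation[of P, OF this]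
  obtain \<psi> where \<psi>: "P j (fps_cutoff (Suc j) \<psi>)" for j by blast
  show ?thesis
  proof
    show c: "const_coeffs \<psi>" using \<psi> by (auto simp: P_def const_coeffs_def)
    have z: "\<psi> $$ 0 = 0" using \<psi>[of 0] by (simp add: P_def)
    then show "\<psi> \<in> max_ideal" using c by (rule const_coeffs_max_ideal[rotated])
    have o: "order_ge 1 \<psi>" using z by (simp add: order_ge_def)
    have "D \<psi> $$ k = 0" for k
    proof (cases "k > r")
      case True
      then obtain j where j: "k = r + j" "j > 0" by (metis less_imp_add_positive)
      have "(D \<psi> - D (fps_cutoff (Suc j) \<psi>)) $$ (r + j) = 0"
        by (subst diff) (simp_all add: z order_ge_def)
      then show ?thesis using \<psi>[of j] j by (simp add: P_def)
    next
      case False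
      have "order_ge r (radial_exp \<psi> G)" "radial_exp \<psi> G $$ r = [:a:]"
        using order_ge_radial_exp[OF o G(2)] radial_exp_leading[OF o G(2)] G(3) by simp_all
      moreover have "order_ge r (C * radial_exp \<psi> X)" "(C * radial_exp \<psi> X) $$ r = [:a:]"
        using order_ge_mult[OF C(2) order_ge_radial_exp[OF o X(2)]] order_ge_mult_nth[OF C(2) order_ge_radial_exp[OF o X(2)]]
          radial_exp_leading[OF o X(2)] r C(3) X(3) by simp_all
      ultimately show ?thesis using False by (cases "k = r") (auto simp: D_def order_ge_def)
    qed
    then show "radial_exp \<psi> G = fps_const [:a:] * fps_X ^ (r - 1) * radial_exp \<psi> fps_X"
      by (simp add: D_def C_def X_def fps_eq_iff)
  qed
qed

lemma nf_series_max_ideal: "r \<ge> 1 \<Longrightarrow> nf_series r b c \<in> max_ideal"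
  unfolding nf_series_def using max_ideal_monomial[of "[:b, 1:]" 1] max_ideal_monomial[of "[:c:]" r] by (simp add: max_ideal_add)

text \<open>
  The straightening field is independent of s, so it multiplies \<open>(s + b) \<rho>\<close> by the same unit by
  which it multiplies the straightened remainder; a time rescaling removes this unit.
\<close>

lemma orbit_equiv_nf_series:
  fixes F :: "'a::field_char_0 poly fps"
  assumes F: "F \<in> max_ideal" and F1: "F $$ Suc 0 = [:b, 1:]"
  obtains r c where "r \<ge> 2" "orbit_equiv F (nf_series r b c)"
proof -
  obtain T where T: "T \<in> max_ideal" and deg: "\<And>k. k \<ge> 2 \<Longrightarrow> degree (((1 + T) * F) $$ k) = 0"
    using weierstrass_preparation[OF assms] by blast
  define G where "G = (1 + T) * F - fps_const [:b, 1:] * fps_X"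
  have eq: "(1 + T) * F = fps_const [:b, 1:] * fps_X + G" by (simp add: G_def)
  have FG: "orbit_equiv F (fps_const [:b, 1:] * fps_X + G)"
    using orbit_equiv_scaling[OF T F] by (simp add: eq)
  have "((1 + T) * F) $$ (0 + 1) = (1 + T) $$ 0 * F $$ 1"
    by (rule order_ge_mult_nth) (use F in \<open>auto simp: order_ge_def max_ideal_def\<close>)
  then have G01: "G $$ 0 = 0" "G $$ Suc 0 = 0"
    using T F by (simp_all add: G_def F1 max_ideal_def)
  have G: "const_coeffs G"
    unfolding const_coeffs_def
  proof
    fix k :: nat
    consider "k = 0" | "k = 1" | "k \<ge> 2" by linarith
    then show "degree (G $$ k) = 0"
    proof cases
      case 3 then show ?thesis using deg[OF 3] by (simp add: G_def)
    qed (simp_all add: G01)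
  qed
  show ?thesis
  proof (cases "G = 0")
    case True
    then show ?thesis using FG by (intro that[of 2 0]) (simp_all add: nf_series_def)
  next
    case False
    define r where "r = subdegree G"
    have ord: "order_ge r G" by (simp add: r_def order_ge_def nth_less_subdegree_zero)
    have Gr: "G $$ r \<noteq> 0" using False by (simp add: r_def)
    have r2: "r \<ge> 2"
    proof (rule ccontr)
      assume "\<not> r \<ge> 2"
      then have "r = 0 \<or> r = Suc 0" by linarith
      then show False using Gr G01 by auto
    qed
    obtain a where a: "G $$ r = [:a:]" using G by (metis const_coeffs_def degree_0_id)
    then have "a \<noteq> 0" using Gr by auto
    then obtain \<psi> where \<psi>: "const_coeffs \<psi>" "\<psi> \<in> max_ideal"
        "radial_exp \<psi> G = fps_const [:a:] * fps_X ^ (r - 1) * radial_exp \<psi> fps_X"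
      using straighten_to_monomial[OF G ord a _ r2] by blast
    define w where "w = radial_exp \<psi> (fps_X :: 'a poly fps)"
    \<comment> \<open>the image w of \<open>\<rho>\<close> is \<open>(1 + V) \<rho>\<close>\<close>
    define V where "V = fps_shift 1 w - 1"
    have X: "order_ge 1 (fps_X :: 'a poly fps)" by (simp add: order_ge_def)
    have w: "const_coeffs w" "w $$ 0 = 0" "w $$ 1 = 1"
      using radial_exp_leading[OF order_ge_max_ideal[OF \<psi>(2)] X] order_ge_radial_exp[OF order_ge_max_ideal[OF \<psi>(2)] X]
        const_coeffs_radial_exp[OF \<psi>(1) const_coeffs_X_power[of 1]] by (simp_all add: w_def order_ge_def)
    have shift: "const_coeffs (fps_shift 1 w)" using w(1) by (simp add: const_coeffs_def)
    have V: "V \<in> max_ideal"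
      unfolding V_def using w
      by (intro const_coeffs_max_ideal const_coeffs_diff shift) (simp_all add: const_coeffs_def)
    have "fps_shift 1 w * fps_X = w"
      using w(2) by (simp add: fps_eq_iff fps_X_mult_right_nth)
    then have wV: "w = (1 + V) * fps_X" by (simp add: V_def)
    have "radial_exp \<psi> (fps_const [:b, 1:] * fps_X + G) =
        fps_const [:b, 1:] * w + fps_const [:a:] * fps_X ^ (r - 1) * w"
      by (simp only: radial_exp_add radial_exp_const_mult \<psi>(3) w_def)
    moreover have "p * w + q * fps_X ^ (r - 1) * w = (1 + V) * (p * fps_X + q * fps_X ^ r)" for p q
    proof -
      have X: "fps_X ^ r = fps_X ^ (r - 1) * (fps_X :: 'a poly fps)"
        using r2 by (simp flip: power_Suc2)
      have "p * (v * x) + q * y * (v * x) = v * (p * x + q * (y * x))" for v x y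
        by (simp add: algebra_simps)
      from this[of "1 + V" fps_X "fps_X ^ (r - 1)"] show ?thesis
        by (simp only: X flip: wV)
    qed
    ultimately have "radial_exp \<psi> (fps_const [:b, 1:] * fps_X + G) = (1 + V) * nf_series r b a"
      by (simp only: nf_series_def)
    moreover have "fps_const [:b, 1:] * fps_X + G \<in> max_ideal"
      using FG unfolding orbit_equiv_def by blast
    ultimately have "orbit_equiv (fps_const [:b, 1:] * fps_X + G) ((1 + V) * nf_series r b a)"
      using orbit_equiv_exp[OF \<psi>(2)] by metis
    with FG have "orbit_equiv F ((1 + V) * nf_series r b a)" by (rule orbit_equiv_trans)
    moreover have "orbit_equiv ((1 + V) * nf_series r b a) (nf_series r b a)"
      using r2 by (intro orbit_equiv_sym[OF orbit_equiv_scaling[OF V]] nf_series_max_ideal) simp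
    ultimately have "orbit_equiv F (nf_series r b a)" by (rule orbit_equiv_trans)
    then show ?thesis by (rule that[OF r2])
  qed
qed

section \<open>The rotating frame\<close>

text \<open>
  A field commuting with the rotation is constant along its flow.
\<close>

lemma flow_pullback_invariant:
  assumes "lie Theta w = 0"
  shows "flow_pullback s (fps_const w) = fps_const w"
proof (rule fps_ext)
  fix n
  have "(lie Theta ^^ j) w = 0" if "j > 0" for j
    using that assms by (induction j) (auto simp: funpow_swap1, metis funpow_0 gr0I lie_zero_right funpow_swap1)
  moreover have "(lie Theta ^^ j) 0 = 0" for j
    by (induction j) simp_all
  ultimately have "vf_scale (s ^ j / fact j) ((lie Theta ^^ j) (fps_const w $$ (n - j))) =
      (if j = 0 \<and> n = 0 then w else 0)" if "j \<le> n" for j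
    using that by (cases "j = 0") auto
  then show "flow_pullback s (fps_const w) $$ n = fps_const w $$ n"
    by (simp add: flow_pullback_def)
qed

lemma lie_Theta_Theta_add: "F \<in> max_ideal \<Longrightarrow> lie Theta (Theta + radial F) = 0"
  by (simp add: lie_add_right lie_self)

lemma fps_const_inject: "fps_const x = fps_const y \<longleftrightarrow> x = y"
  by (auto dest: arg_cong[of _ _ "\<lambda>f. f $$ 0"])

lemma remove_rotation_Theta_add: "F \<in> max_ideal \<Longrightarrow> remove_rotation (Theta + radial F) = radial F"
  by (simp add: remove_rotation_def to_rotating_frame_def flow_pullback_invariant
      lie_Theta_Theta_add fps_const_inject)

lemma restore_rotation_radial: "F \<in> max_ideal \<Longrightarrow> restore_rotation (radial F) = Theta + radial F"
  by (simp add: restore_rotation_def from_rotating_frame_def flow_pullback_invariant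
      lie_Theta_Theta_add fps_const_inject add.commute[of "radial F"])

lemma orbital_nf_eq:
  assumes "r \<ge> 1"
  shows "orbital_nf r b c = Theta + radial (nf_series r b c)"
proof -
  have "nf_series r b c = mono_fps 1 1 + fps_const [:b:] * mono_fps 0 1 + fps_const [:c:] * mono_fps 0 r"
    by (simp add: fps_eq_iff nf_series_def mono_fps_def monom_altdef one_pCons)
  then show ?thesis
    using assms by (simp add: orbital_nf_def Emon_eq radial_add vf_scale_radial)
qed

section \<open>Symmetries generated by multiples of the field\<close>

text \<open>
  The bracket of two multiples of F is divisible by the square of F. Iterated brackets of \<open>F h\<close>
  with F thus stay multiples of F.
\<close>

lemma radial_bracket_mult_mult: "radial_bracket (F * h) (F * q) = F * (F * radial_bracket h q)"
  by (simp add: radial_bracket_def XD_mult algebra_simps)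

lemma radial_exp_multiple_of_self:
  assumes F: "F \<in> max_ideal" and h: "degree_bounded h"
  obtains V where "V \<in> max_ideal" "radial_exp (F * h) F = (1 + V) * F"
proof -
  define q where "q n = ((\<lambda>p. F * radial_bracket h p) ^^ n) 1" for n
  have ord: "order_ge n (q n)" for n
  proof (induction n)
    case (Suc n)
    have "order_ge (0 + n) (radial_bracket h (q n))"
      by (rule order_ge_radial_bracket[OF _ Suc]) (simp add: order_ge_def)
    then show ?case using order_ge_mult[OF order_ge_max_ideal[OF F]] by (simp add: q_def)
  qed (simp add: order_ge_def)
  have degree_bounded: "degree_bounded (q n)" for n
    by (induction n) (simp_all add: q_def degree_bounded_mult degree_bounded_radial_bracket max_ideal_degree_bounded F h)
  have pow: "(radial_bracket (F * h) ^^ n) F = F * q n" for n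
    by (induction n) (simp_all add: q_def radial_bracket_mult_mult)
  define U where "U = graded_sum (\<lambda>n. fps_const [:1 / fact n:] * q n)"
  have "radial_exp (F * h) F = graded_sum (\<lambda>n. F * (fps_const [:1 / fact n:] * q n))"
    by (simp add: radial_exp_def pow mult.left_commute)
  also have "\<dots> = F * U"
    unfolding U_def by (intro graded_sum_mult order_ge_const_mult ord)
  finally have "radial_exp (F * h) F = (1 + (U - 1)) * F" by (simp add: mult.commute)
  moreover have "U - 1 \<in> max_ideal"
  proof -
    have "degree_bounded U" unfolding U_def by (intro degree_bounded_graded_sum degree_bounded_mult degree_bounded_const degree_bounded)
    moreover have "U $$ 0 = 1" by (simp add: U_def graded_sum_def q_def)
    ultimately show ?thesis by (simp add: max_ideal_def degree_bounded_diff)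
  qed
  ultimately show ?thesis by (rule that[rotated])
qed

text \<open>
  The exponential of \<open>F h\<close> multiplies F by a unit, and the time rescaling by the inverse unit
  makes the composition fix F.
\<close>

lemma symmetry_exists:
  fixes F h :: "'a::field_char_0 poly fps"
  assumes F: "F \<in> max_ideal" and h: "degree_bounded h"
  obtains g T where "g \<in> permissible" "T \<in> max_ideal" "g (radial F) = radial F"
    "\<And>G. G \<in> max_ideal \<Longrightarrow> g (radial G) = radial ((1 + T) * radial_exp (F * h) G)"
proof -
  obtain V where V: "V \<in> max_ideal" "radial_exp (F * h) F = (1 + V) * F"
    using radial_exp_multiple_of_self[OF assms] by blast
  have S: "F * h \<in> max_ideal" using max_ideal_mult[OF h F] by (simp add: mult.commute)
  have "- V \<in> (\<lambda>T. (1 + V) * T) ` max_ideal"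
    using bij_betw_scaling[OF V(1)] V(1) max_ideal_diff[of 0 V] by (auto simp: bij_betw_def max_ideal_def)
  then obtain T where T: "T \<in> max_ideal" "(1 + V) * T = - V" by auto
  then have inverse: "(1 + T) * (1 + V) = 1" by (simp add: algebra_simps)
  define g where "g = compose E_alg (restrict (\<lambda>u. (1 + to_ps T) *s u) E_alg) (restrict (exp_ad (radial (F * h))) E_alg)"
  have act: "g (radial G) = radial ((1 + T) * radial_exp (F * h) G)" if "G \<in> max_ideal" for G
    using that by (simp add: g_def compose_def radial_in_E_alg exp_ad_radial S radial_exp_max_ideal one_plus_to_ps_scale_radial T(1))
  have "(1 + T) * radial_exp (F * h) F = F"
    unfolding V(2) mult.assoc[symmetric] inverse by simp
  then have "g (radial F) = radial F" using act[OF F] by simp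
  moreover have "g \<in> permissible"
    unfolding g_def by (intro permissible_compose permissible_scaling permissible_exp T(1) S)
  ultimately show ?thesis using that T(1) act by blast
qed

text \<open>
  Suppose h and h' first differ at \<open>\<rho>\<^sup>j\<close>. The unknown time rescalings drop out of the ratio of
  the images of two elements, here of F, of order 1, and of \<open>\<rho>\<^sup>2\<close>. The two ratios differ at
  lowest order by the factors \<open>1 - (j + 1)\<close> and \<open>2 - (j + 1)\<close>, which are never equal; a second
  test element of order 1 would give equal factors.
\<close>

lemma symmetry_determines_parameter:
  fixes F :: "'a::field_char_0 poly fps"
  assumes F: "F \<in> max_ideal" "F $$ 1 \<noteq> 0" and h: "degree_bounded h" "degree_bounded h'" and T: "T \<in> max_ideal" "T' \<in> max_ideal"
    and fix1: "(1 + T) * radial_exp (F * h) F = F" and fix2: "(1 + T') * radial_exp (F * h') F = F"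
    and eq: "(1 + T) * radial_exp (F * h) (fps_X ^ 2) = (1 + T') * radial_exp (F * h') (fps_X ^ 2)"
  shows "h = h'"
proof (rule ccontr)
  assume "h \<noteq> h'"
  define w where "w = (fps_X ^ 2 :: 'a poly fps)"
  define j where "j = subdegree (h - h')"
  define d where "d = (h - h') $$ j"
  have d: "d \<noteq> 0" using \<open>h \<noteq> h'\<close> by (simp add: d_def j_def del: fps_sub_nth)
  define P where "P = radial_exp (F * h)"
  define P' where "P' = radial_exp (F * h')"
  have S: "order_ge 1 (F * h)" "order_ge 1 (F * h')"
    using order_ge_mult_left[OF order_ge_max_ideal[OF F(1)], of h] order_ge_mult_left[OF order_ge_max_ideal[OF F(1)], of h']
    by (simp_all only: mult.commute[of F])
  have w: "order_ge 2 w" "w $$ 2 = 1" by (simp_all add: w_def order_ge_def)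
  have hj: "order_ge j (h - h')" by (simp add: j_def order_ge_def nth_less_subdegree_zero del: fps_sub_nth)
  have diff: "order_ge (1 + j) (F * h - F * h')" "(F * h - F * h') $$ (1 + j) = F $$ 1 * d"
    using order_ge_mult[OF order_ge_max_ideal[OF F(1)] hj] order_ge_mult_nth[OF order_ge_max_ideal[OF F(1)] hj]
    by (simp_all only: right_diff_distrib d_def)
  define Y where "Y = (1 + T) * P w"
  have Y': "Y = (1 + T') * P' w" using eq by (simp add: Y_def P_def P'_def w_def)
  have Pw: "order_ge 2 (P w)" "P w $$ 2 = 1"
    using order_ge_radial_exp[OF S(1) w(1)] radial_exp_leading[OF S(1) w(1)] w(2) by (simp_all add: P_def)
  have T0: "order_ge 0 (1 + T)" "(1 + T) $$ 0 = 1" using T(1) by (simp_all add: order_ge_def max_ideal_def)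
  have Y: "order_ge 2 Y" "Y $$ 2 = 1"
    using order_ge_mult[OF T0(1) Pw(1)] order_ge_mult_nth[OF T0(1) Pw(1)]
    by (simp_all only: Y_def add_0 T0(2) Pw(2) mult_1)
  \<comment> \<open>cross-multiplied form of the equality of the two ratios\<close>
  have "P F * Y = ((1 + T) * P F) * P w" by (simp add: Y_def mult_ac)
  moreover have "P' F * Y = ((1 + T') * P' F) * P' w" by (simp add: Y' mult_ac)
  ultimately have key: "(P F - P' F) * Y = F * (P w - P' w)"
    using fix1 fix2 by (simp add: P_def P'_def left_diff_distrib right_diff_distrib)
  note dF = radial_exp_diff_left[OF S diff(1) order_ge_max_ideal[OF F(1)], folded P_def P'_def]
  note dw = radial_exp_diff_left[OF S diff(1) w(1), folded P_def P'_def]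
  have "((P F - P' F) * Y) $$ ((1 + (1 + j)) + 2) = (of_nat 1 - of_nat (1 + j)) * ((F $$ 1 * d) * F $$ 1)"
    using order_ge_mult_nth[OF dF(1) Y(1)] unfolding dF(2) diff(2) Y(2) by simp
  moreover have "(F * (P w - P' w)) $$ (1 + (2 + (1 + j))) = F $$ 1 * ((of_nat 2 - of_nat (1 + j)) * (F $$ 1 * d))"
    using order_ge_mult_nth[OF order_ge_max_ideal[OF F(1)] dw(1)] unfolding dw(2) diff(2) w(2) by simp
  moreover have "(1 + (1 + j)) + 2 = 1 + (2 + (1 + j))" by simp
  ultimately have "(of_nat 1 - of_nat (1 + j)) * ((F $$ 1 * d) * F $$ 1) =
      F $$ 1 * ((of_nat 2 - of_nat (1 + j)) * (F $$ 1 * d))"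
    using key by metis
  then have "F $$ 1 * (F $$ 1 * d) = 0" by (simp add: algebra_simps)
  then show False using F(2) d by simp
qed

section \<open>Uncountability of the symmetry group\<close>

text \<open>
  Every element arises from the generators, their inverses and the unit by finitely many rounds
  of forming all products of two elements, and each round preserves countability.
\<close>

lemma countable_generate:
  assumes "countable H"
  shows "countable (generate G H)"
proof -
  define step where "step A = A \<union> (\<lambda>(x, y). x \<otimes>\<^bsub>G\<^esub> y) ` (A \<times> A)" for A
  define B where "B n = (step ^^ n) ({\<one>\<^bsub>G\<^esub>} \<union> H \<union> (\<lambda>h. inv\<^bsub>G\<^esub> h) ` H)" for n
  have B_Suc: "B (Suc n) = step (B n)" for n by (simp add: B_def)
  have "countable (B n)" for n
  proof (induction n)
    case 0
    show ?case by (simp add: B_def assms)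
  next
    case (Suc n)
    then show ?case unfolding B_Suc step_def by simp
  qed
  then have countable: "countable (\<Union>n. B n)" by blast
  have "B n \<subseteq> B (Suc n)" for n by (auto simp: B_Suc step_def)
  then have mono: "B m \<subseteq> B n" if "m \<le> n" for m n by (rule lift_Suc_mono_le[OF _ that])
  have B0: "{\<one>\<^bsub>G\<^esub>} \<union> H \<union> (\<lambda>h. inv\<^bsub>G\<^esub> h) ` H \<subseteq> (\<Union>n. B n)"
    using UN_upper[of 0 UNIV B] by (simp add: B_def)
  have "x \<in> (\<Union>n. B n)" if "x \<in> generate G H" for x
    using that
  proof induction
    case (eng x y)
    then obtain m n where "x \<in> B m" "y \<in> B n" by auto
    then have "x \<in> B (max m n)" "y \<in> B (max m n)"
      using mono[of m "max m n"] mono[of n "max m n"] by auto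
    then have "x \<otimes>\<^bsub>G\<^esub> y \<in> B (Suc (max m n))"
      unfolding B_Suc step_def by blast
    then show ?case by blast
  qed (use B0 in blast)+
  then show ?thesis using countable by (meson countable_subset subsetI)
qed

lemma uncountable_nat_sets: "uncountable (UNIV :: nat set set)"
  using Cantors_theorem[of "UNIV :: nat set"] unfolding uncountable_def Pow_UNIV by blast

lemma Theta_radial_in_Theta_E: "F \<in> max_ideal \<Longrightarrow> Theta + radial F \<in> Theta_E"
  by (simp add: Theta_E_def radial_in_E_alg)

lemma conj_rotation_apply:
  assumes "F \<in> max_ideal" "G \<in> max_ideal" "g (radial F) = radial G"
  shows "conj_rotation g (Theta + radial F) = Theta + radial G"
  using assms by (simp add: conj_rotation_def Theta_radial_in_Theta_E remove_rotation_Theta_add restore_rotation_radial)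

lemma symmetry_group_not_finitely_generated:
  fixes F :: "'a::field_char_0 poly fps"
  assumes F: "F \<in> max_ideal" "F $$ 1 \<noteq> 0"
  shows "\<not> finitely_generated_group (symmetry_group (Theta + radial F))"
proof
  let ?G = "symmetry_group (Theta + radial F)"
  assume "finitely_generated_group ?G"
  then have countable: "countable (carrier ?G)"
    unfolding finitely_generated_group_def by (metis countable_finite countable_generate)
  \<comment> \<open>one symmetry for each set of natural numbers\<close>
  define h where "h A = Abs_fps (\<lambda>i. if i \<in> A then 1 else 0 :: 'a poly)" for A
  have h: "degree_bounded (h A)" for A by (simp add: h_def degree_bounded_def)
  define Q where "Q A p \<longleftrightarrow> fst p \<in> permissible \<and> snd p \<in> max_ideal \<and> fst p (radial F) = radial F \<and>
      (\<forall>G\<in>max_ideal. fst p (radial G) = radial ((1 + snd p) * radial_exp (F * h A) G))" for A p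
  have "\<exists>p. Q A p" for A
  proof -
    obtain g T where "g \<in> permissible" "T \<in> max_ideal" "g (radial F) = radial F"
        "\<And>G. G \<in> max_ideal \<Longrightarrow> g (radial G) = radial ((1 + T) * radial_exp (F * h A) G)"
      using symmetry_exists[OF F(1) h[of A]] by blast
    then have "Q A (g, T)" by (simp add: Q_def)
    then show ?thesis ..
  qed
  then obtain p where p: "Q A (p A)" for A using choice[of Q] by blast
  define g where "g A = fst (p A)" for A
  define T where "T A = snd (p A)" for A
  have g: "g A \<in> permissible" and T: "T A \<in> max_ideal" and inv: "g A (radial F) = radial F"
    and act: "G \<in> max_ideal \<Longrightarrow> g A (radial G) = radial ((1 + T A) * radial_exp (F * h A) G)" for A G
    using p[of A] by (simp_all add: Q_def g_def T_def)
  have S: "F * h A \<in> max_ideal" for A using max_ideal_mult[OF h F(1)] by (simp add: mult.commute)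
  have val: "(1 + T A) * radial_exp (F * h A) G \<in> max_ideal" if "G \<in> max_ideal" for A G
    by (intro one_plus_mult_max_ideal T radial_exp_max_ideal S that)
  have conj: "conj_rotation (g A) (Theta + radial G) = Theta + radial ((1 + T A) * radial_exp (F * h A) G)"
    if "G \<in> max_ideal" for A G
    by (rule conj_rotation_apply[of G "(1 + T A) * radial_exp (F * h A) G" "g A"]) (simp_all add: that val act)
  have inj: "inj (\<lambda>A. conj_rotation (g A))"
  proof (rule injI)
    fix A B assume eq: "conj_rotation (g A) = conj_rotation (g B)"
    have same: "(1 + T A) * radial_exp (F * h A) G = (1 + T B) * radial_exp (F * h B) G" if G: "G \<in> max_ideal" for G
    proof -
      have "Theta + radial ((1 + T A) * radial_exp (F * h A) G) = conj_rotation (g A) (Theta + radial G)"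
        by (rule conj[OF G, symmetric])
      also have "\<dots> = Theta + radial ((1 + T B) * radial_exp (F * h B) G)"
        unfolding eq by (rule conj[OF G])
      finally have "radial ((1 + T A) * radial_exp (F * h A) G) = radial ((1 + T B) * radial_exp (F * h B) G)"
        by (rule add_left_imp_eq)
      then show ?thesis
        by (rule radial_inject[OF max_ideal_degree_bounded[OF val[OF G]] max_ideal_degree_bounded[OF val[OF G]]])
    qed
    have fixed: "(1 + T A) * radial_exp (F * h A) F = F" for A
      by (rule radial_inject[OF max_ideal_degree_bounded[OF val[OF F(1)]] max_ideal_degree_bounded[OF F(1)]])
        (rule trans[OF act[OF F(1), symmetric] inv])
    have "fps_X ^ 2 \<in> (max_ideal :: 'a poly fps set)" using max_ideal_monomial[of 1 2] by simp
    then have same_h: "h A = h B"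
      by (intro symmetry_determines_parameter[OF F h h T T fixed fixed] same)
    have supp: "{i. h A $$ i \<noteq> 0} = A" for A by (simp add: h_def)
    have "A = {i. h A $$ i \<noteq> 0}" by (rule supp[symmetric])
    also have "\<dots> = {i. h B $$ i \<noteq> 0}" by (simp only: same_h)
    also have "\<dots> = B" by (rule supp)
    finally show "A = B" .
  qed
  have "conj_rotation (g A) \<in> carrier ?G" for A
    using g[of A] inv[of A] by (auto simp: symmetry_group_def remove_rotation_Theta_add[OF F(1)])
  then have "range (\<lambda>A. conj_rotation (g A)) \<subseteq> carrier ?G" by blast
  then have "countable (range (\<lambda>A. conj_rotation (g A)))"
    by (rule countable_subset[OF _ countable])
  then have "countable (UNIV :: nat set set)"
    by (rule countable_image_inj_on[OF _ inj])
  then show False using uncountable_nat_sets by blast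
qed

section \<open>Fields commuting with the normal form\<close>

lemma nf_series_nth:
  assumes "r \<ge> 2"
  shows "nf_series r b c $$ k = (if k = 1 then [:b, 1:] else if k = r then [:c:] else 0)"
  using assms by (auto simp: nf_series_def)

lemma act_nf_series:
  assumes "r \<ge> 2"
  shows "radial_bracket G (nf_series r b c) = (G - fps_XD G) * nf_series r b c + fps_const [:(of_nat r - 1) * c:] * (fps_X ^ r * G)"
proof -
  have "fps_XD (nf_series r b c) = nf_series r b c + fps_const [:(of_nat r - 1) * c:] * fps_X ^ r"
    using assms by (simp add: fps_eq_iff nf_series_nth of_nat_poly algebra_simps)
  then show ?thesis by (simp add: radial_bracket_def algebra_simps)
qed

lemma mult_nf_series_nth:
  assumes "r \<ge> 2"
  shows "(q * nf_series r b c) $$ Suc k = [:b, 1:] * q $$ k + (if r \<le> Suc k then smult c (q $$ (Suc k - r)) else 0)"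
proof -
  have "q * nf_series r b c = fps_X * (fps_const [:b, 1:] * q) + fps_X ^ r * (fps_const [:c:] * q)"
    by (simp add: nf_series_def algebra_simps)
  then show ?thesis by (simp add: fps_X_power_mult_nth)
qed

text \<open>
  The coefficient of \<open>\<rho>\<^sup>k\<^sup>+\<^sup>1\<close> in the bracket relates \<open>(1 - k) (s + b)\<close> times the k-th
  coefficient of g to an earlier coefficient. For \<open>k = 1\<close> it says nothing, so the first
  coefficient is free; for \<open>k = r\<close> it makes the first coefficient divisible by \<open>s + b\<close>; and it
  determines all coefficients from the first one.
\<close>

lemma commuting_with_nf_series:
  fixes g :: "'a::field_char_0 poly fps"
  assumes g: "g \<in> max_ideal" and r: "r \<ge> 2" and c: "c \<noteq> 0" and comm: "radial_bracket g (nf_series r b c) = 0"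
  obtains a where "g = fps_const [:a:] * nf_series r b c"
proof -
  have rec: "[:b, 1:] * ((1 - of_nat k) * G $$ k) +
      (if r \<le> Suc k then smult c ((of_nat r - of_nat (Suc k - r)) * G $$ (Suc k - r)) else 0) = 0"
    if "radial_bracket G (nf_series r b c) = 0" for G k
  proof -
    have "((G - fps_XD G) * nf_series r b c) $$ Suc k +
        (fps_const [:(of_nat r - 1) * c:] * (fps_X ^ r * G)) $$ Suc k = 0"
      using that act_nf_series[OF r, of G b c] by (metis fps_add_nth fps_zero_nth)
    moreover have "(fps_const [:(of_nat r - 1) * c:] * (fps_X ^ r * G)) $$ Suc k =
        (if r \<le> Suc k then smult ((of_nat r - 1) * c) (G $$ (Suc k - r)) else 0)"
      by (simp add: fps_X_power_mult_nth)
    moreover have "smult c (p - of_nat m * p) + smult ((of_nat r - 1) * c) p = smult c ((of_nat r - of_nat m) * p)"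
      for m and p :: "'a poly"
      unfolding left_diff_distrib by (rule poly_eqI) (simp add: of_nat_poly algebra_simps)
    moreover have "(G - fps_XD G) $$ j = G $$ j - of_nat j * G $$ j" for j
      by simp
    moreover have "(1 - of_nat k) * G $$ k = G $$ k - of_nat k * G $$ k"
      unfolding left_diff_distrib by simp
    ultimately show ?thesis
      unfolding mult_nf_series_nth[OF r]
      by (cases "r \<le> Suc k") (simp_all only: if_True if_False add.assoc add_0_right)
  qed
  have vanish: "G = 0" if G: "G \<in> max_ideal" "G $$ 1 = 0" "radial_bracket G (nf_series r b c) = 0" for G
  proof -
    have "G $$ k = 0" for k
    proof (induction k rule: less_induct)
      case (less k)
      consider "k = 0" | "k = 1" | "k \<ge> 2" by linarith
      then show ?case
      proof cases
        case 3
        then have "G $$ (Suc k - r) = 0" using less r by simp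
        then have "[:b, 1:] * ((1 - of_nat k) * G $$ k) = 0"
          using rec[OF G(3), of k] by (simp del: mult_pCons_left split: if_splits)
        moreover have "1 - of_nat k \<noteq> (0 :: 'a poly)"
        proof
          assume "1 - of_nat k = (0 :: 'a poly)"
          then have "of_nat k = (of_nat 1 :: 'a poly)" by simp
          then show False using 3 unfolding of_nat_eq_iff by simp
        qed
        ultimately show ?thesis by (simp del: mult_pCons_left)
      qed (use G in \<open>simp_all add: max_ideal_def\<close>)
    qed
    then show ?thesis by (simp add: fps_eq_iff)
  qed
  have r1: "of_nat r - 1 \<noteq> (0 :: 'a)"
  proof
    assume "of_nat r - 1 = (0 :: 'a)"
    then have "of_nat r = (of_nat 1 :: 'a)" by simp
    then show False using r unfolding of_nat_eq_iff by simp
  qed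
  have "[:b, 1:] * ((1 - of_nat r) * g $$ r) + smult c ((of_nat r - 1) * g $$ 1) = 0"
    using rec[OF comm, of r] by simp
  \<comment> \<open>evaluation at \<open>s = - b\<close> removes the multiple of \<open>s + b\<close>\<close>
  from arg_cong[OF this, of "\<lambda>p. poly p (- b)"]
  have "c * ((of_nat r - 1) * poly (g $$ 1) (- b)) = 0"
    by (simp add: of_nat_poly)
  then have root: "poly (g $$ 1) (- b) = 0"
    using c r1 by simp
  define a where "a = coeff (g $$ 1) 1"
  have deg: "degree (g $$ 1) \<le> 1" using g by (simp add: max_ideal_def degree_bounded_def)
  have "coeff (g $$ 1) n = coeff [:a * b, a:] n" for n
  proof -
    have g1: "g $$ 1 = [:coeff (g $$ 1) 0, coeff (g $$ 1) 1:]"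
    proof (rule poly_eqI)
      fix n
      show "coeff (g $$ 1) n = coeff [:coeff (g $$ 1) 0, coeff (g $$ 1) 1:] n"
      proof (cases "n \<le> 1")
        case True then show ?thesis by (cases n) auto
      next
        case False
        then have "coeff (g $$ 1) n = 0" using deg by (intro coeff_eq_0) linarith
        then show ?thesis using False by (auto simp: coeff_pCons split: nat.split)
      qed
    qed
    have "poly [:coeff (g $$ 1) 0, coeff (g $$ 1) 1:] (- b) = 0"
      using root unfolding g1[symmetric] .
    then have "coeff (g $$ 1) 0 = a * b" unfolding a_def by (simp add: mult.commute[of b])
    then show ?thesis using arg_cong[OF g1, of "\<lambda>p. coeff p n"] unfolding a_def by simp
  qed
  then have "g $$ 1 = [:a * b, a:]" by (rule poly_eqI)
  moreover have "nf_series r b c $$ 1 = [:b, 1:]"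
    using r by (simp add: nf_series_nth)
  ultimately have lead: "(g - fps_const [:a:] * nf_series r b c) $$ 1 = 0"
    by simp
  have "g - fps_const [:a:] * nf_series r b c \<in> max_ideal"
    using r by (intro max_ideal_diff max_ideal_mult degree_bounded_const nf_series_max_ideal g) auto
  moreover have "radial_bracket (g - fps_const [:a:] * nf_series r b c) (nf_series r b c) = 0"
    unfolding radial_bracket_diff_left comm
    by (simp only: radial_bracket_def fps_XD_mult_const mult_ac diff_self)
  ultimately have "g - fps_const [:a:] * nf_series r b c = 0" using lead vanish by blast
  then show ?thesis by (intro that[of a]) simp
qed

section \<open>Complements through a given vector\<close>

text \<open>
  Extend a basis of W by p, if p is nonzero, and then to a basis of V; the basis vectors outside
  W span the complement.
\<close>

lemma complement_through:
  fixes V W :: "'a::field_char_0 vf set"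
  assumes V: "vf.subspace V" and W: "vf.subspace W" "W \<subseteq> V" and p: "p \<in> V" "p \<in> W \<Longrightarrow> p = 0"
  obtains C where "complement_in V W C" "p \<in> C"
proof -
  obtain B where B: "B \<subseteq> W" "vf.independent B" "W \<subseteq> vf.span B"
    using vf.maximal_independent_subset[of W] by blast
  then have spanB: "vf.span B = W"
    by (intro antisym vf.span_minimal W)
  define B' where "B' = (if p = 0 then B else insert p B)"
  have "vf.independent B'"
    using B(2) p spanB by (auto simp: B'_def vf.independent_insert)
  moreover have "B' \<subseteq> V" using B(1) W(2) p by (auto simp: B'_def)
  ultimately obtain D where D: "B' \<subseteq> D" "D \<subseteq> V" "vf.independent D" "V \<subseteq> vf.span D"
    using vf.maximal_independent_subset_extend by blast
  have BD: "B \<subseteq> D" using D(1) by (auto simp: B'_def split: if_splits)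
  define C where "C = vf.span (D - B)"
  have spanD: "vf.span D = V" using D V by (intro antisym vf.span_minimal)
  have "p \<in> C"
  proof (cases "p = 0")
    case False
    then have "p \<notin> B" using p(2) B(1) by blast
    then show ?thesis using False D(1) by (auto simp: C_def B'_def intro: vf.span_base)
  qed (simp add: C_def vf.span_zero)
  moreover have "complement_in V W C"
    unfolding complement_in_def
  proof (intro conjI)
    show "vf.subspace C" by (simp add: C_def)
    show "{a + b | a b. a \<in> C \<and> b \<in> W} = V"
    proof -
      have "vf.span ((D - B) \<union> B) = {a + b | a b. a \<in> C \<and> b \<in> W}"
        unfolding vf.span_Un C_def spanB by blast
      moreover have "(D - B) \<union> B = D" using BD by blast
      ultimately show ?thesis using spanD by simp
    qed
    show "C \<inter> W = {0}"
    proof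
      show "C \<inter> W \<subseteq> {0}"
      proof
        fix x assume x: "x \<in> C \<inter> W"
        have "vf.representation D x = vf.representation (D - B) x"
          using x by (intro vf.representation_extend[OF D(3)]) (auto simp: C_def)
        moreover have "vf.representation D x = vf.representation B x"
          using x BD by (intro vf.representation_extend[OF D(3)]) (auto simp: spanB)
        ultimately have "vf.representation D x b = 0" for b
          using vf.representation_ne_zero[of "D - B" x b] vf.representation_ne_zero[of B x b] by force
        then show "x \<in> {0}"
          using x vf.sum_nonzero_representation_eq[OF D(3), of x] spanD W(2) by auto
      qed
    qed (simp add: C_def vf.span_zero vf.subspace_0[OF W(1)])
  qed
  ultimately show ?thesis by (rule that[rotated])
qed

section \<open>The grading\<close>

definition homogeneous :: "nat \<Rightarrow> 'a::field_char_0 poly fps \<Rightarrow> bool" where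
  "homogeneous i F \<longleftrightarrow> (\<forall>k l. coeff (F $$ k) l \<noteq> 0 \<longrightarrow> l \<le> k \<and> grade l k = i)"

definition graded_part :: "nat \<Rightarrow> 'a::field_char_0 poly fps \<Rightarrow> 'a poly fps" where
  "graded_part i F = gen_fps (\<lambda>l k. if grade l k = i then coeff (F $$ k) l else 0)"

lemma coeff_graded_part: "degree_bounded F \<Longrightarrow> coeff (graded_part i F $$ k) l = (if grade l k = i then coeff (F $$ k) l else 0)"
  unfolding graded_part_def by (subst coeff_gen_fps) (auto simp: degree_bounded_coeff split: if_splits)

lemma hom_image_eq:
  shows "E_hom i = (radial ` {F \<in> max_ideal. homogeneous i F} :: 'a::field_char_0 vf set)"
    and "R_hom i = (to_ps ` {F \<in> max_ideal. homogeneous i F} :: 'a ps set)"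
proof -
  let ?B = "{\<beta> \<in> E_coeffs. \<forall>l k. \<beta> l k \<noteq> (0 :: 'a) \<longrightarrow> grade l k = i}"
  have B: "gen_fps ` ?B = {F \<in> max_ideal. homogeneous i F}"
  proof
    show "gen_fps ` ?B \<subseteq> {F \<in> max_ideal. homogeneous i F}"
      by (auto simp: gen_fps_in_max_ideal homogeneous_def coeff_gen_fps E_coeffs_supp)
    show "{F \<in> max_ideal. homogeneous i F} \<subseteq> gen_fps ` ?B"
    proof
      fix F :: "'a poly fps" assume "F \<in> {F \<in> max_ideal. homogeneous i F}"
      then show "F \<in> gen_fps ` ?B"
        by (intro image_eqI[of _ _ "\<lambda>l k. coeff (F $$ k) l"])
           (auto simp: gen_fps_coeffs max_ideal_degree_bounded coeffs_of_max_ideal homogeneous_def)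
    qed
  qed
  show "E_hom i = (radial ` {F \<in> max_ideal. homogeneous i F} :: 'a vf set)"
    unfolding E_hom_def B[symmetric] image_image by (rule image_cong) (auto simp: E_series_gen_fps)
  show "R_hom i = (to_ps ` {F \<in> max_ideal. homogeneous i F} :: 'a ps set)"
    unfolding R_hom_def R_coeffs_eq B[symmetric] image_image by (rule image_cong) (auto simp: R_series_gen_fps)
qed

lemma hpart_radial: "F \<in> max_ideal \<Longrightarrow> hpart (radial F) i = radial (graded_part i F)"
  unfolding hpart_def E_coeff_of_radial
  by (rule series_eq(1)) (auto simp: coeff_graded_part max_ideal_degree_bounded split: if_splits, use max_ideal_degree_bounded degree_bounded_coeff in blast)

lemma homogeneous_degree_bounded: "homogeneous i F \<Longrightarrow> degree_bounded F"
  by (auto simp: homogeneous_def degree_bounded_coeff)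

lemma homogeneous_graded_part: "degree_bounded F \<Longrightarrow> homogeneous i (graded_part i F)"
  by (auto simp: homogeneous_def coeff_graded_part degree_bounded_coeff split: if_splits)

lemma graded_part_max_ideal: "F \<in> max_ideal \<Longrightarrow> graded_part i F \<in> max_ideal"
proof -
  assume F: "F \<in> max_ideal"
  then have "graded_part i F $$ 0 = 0"
    by (intro poly_eqI) (simp add: coeff_graded_part max_ideal_degree_bounded, simp add: max_ideal_def)
  then show ?thesis using F homogeneous_degree_bounded[OF homogeneous_graded_part] by (auto simp: max_ideal_def)
qed

lemma coeff_of_nat_mult: "coeff (of_nat n * p) l = of_nat n * coeff p l" for p :: "'a::field_char_0 poly"
  by (simp add: of_nat_poly)

lemma graded_part_XD: "degree_bounded F \<Longrightarrow> graded_part i (fps_XD F) = fps_XD (graded_part i F)"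
  by (rule fps_ext, rule poly_eqI) (simp add: coeff_graded_part degree_bounded_XD coeff_of_nat_mult)

lemma homogeneous_XD: "homogeneous i F \<Longrightarrow> homogeneous i (fps_XD F)"
  by (auto simp: homogeneous_def coeff_of_nat_mult)

lemma homogeneous_zero: "homogeneous i 0"
  by (simp add: homogeneous_def)

lemma homogeneous_add: "homogeneous i F \<Longrightarrow> homogeneous i G \<Longrightarrow> homogeneous i (F + G)"
  unfolding homogeneous_def by (metis add_0 coeff_add fps_add_nth)

lemma homogeneous_const_mult: "homogeneous i F \<Longrightarrow> homogeneous i (fps_const [:c:] * F)"
  by (simp add: homogeneous_def)

lemma homogeneous_diff: "homogeneous i F \<Longrightarrow> homogeneous i G \<Longrightarrow> homogeneous i (F - G)"
  unfolding homogeneous_def by (metis diff_0_right coeff_diff fps_sub_nth)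

lemma coeff_mult_fps:
  "coeff ((F * G) $$ k) l = (\<Sum>i=0..k. \<Sum>p\<le>l. coeff (F $$ i) p * coeff (G $$ (k - i)) (l - p))"
  for F G :: "'a::field_char_0 poly fps"
  by (simp add: fps_mult_nth coeff_sum coeff_mult)

text \<open>
  The grade \<open>2 k - l\<close> of \<open>s\<^sup>l \<rho>\<^sup>k\<close> is additive; the degree bounds make sure that the
  subtractions of natural numbers are proper.
\<close>

lemma grade_of_product_term:
  assumes "homogeneous a g" "degree_bounded F" "p \<le> l" "i \<le> k"
    and "coeff (g $$ i) p \<noteq> 0" "coeff (F $$ (k - i)) (l - p) \<noteq> 0"
  shows "grade l k = a + grade (l - p) (k - i)"
proof -
  have "p \<le> i" "grade p i = a" using assms by (auto simp: homogeneous_def)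
  moreover have "l - p \<le> k - i" using assms by (auto simp: degree_bounded_coeff)
  ultimately show ?thesis using assms(3,4) unfolding grade_def by linarith
qed

lemma homogeneous_mult:
  assumes "homogeneous i F" "homogeneous j G"
  shows "homogeneous (i + j) (F * G)"
  unfolding homogeneous_def
proof (intro allI impI)
  fix k l assume "coeff ((F * G) $$ k) l \<noteq> 0"
  then obtain m p where *: "m \<in> {0..k}" "p \<in> {..l}" "coeff (F $$ m) p * coeff (G $$ (k - m)) (l - p) \<noteq> 0"
    unfolding coeff_mult_fps by (meson sum.not_neutral_contains_not_neutral)
  then have nz: "coeff (F $$ m) p \<noteq> 0" "coeff (G $$ (k - m)) (l - p) \<noteq> 0" by auto
  then have "grade l k = i + grade (l - p) (k - m)"
    using * by (intro grade_of_product_term[OF assms(1) homogeneous_degree_bounded[OF assms(2)]]) auto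
  moreover have "p \<le> m" "l - p \<le> k - m" "grade (l - p) (k - m) = j"
    using nz assms by (auto simp: homogeneous_def)
  ultimately show "l \<le> k \<and> grade l k = i + j"
    using * by auto
qed

text \<open>
  Multiplication by a homogeneous series shifts the grading.
\<close>

lemma coeff_homogeneous_mult:
  assumes "homogeneous a g" "degree_bounded F"
  shows "coeff ((g * F) $$ k) l =
    (if a \<le> grade l k then coeff ((g * graded_part (grade l k - a) F) $$ k) l else 0)"
proof -
  have summand: "coeff (g $$ i) p * coeff (F $$ (k - i)) (l - p) =
     (if a \<le> grade l k then coeff (g $$ i) p * coeff (graded_part (grade l k - a) F $$ (k - i)) (l - p) else 0)"
    if "i \<in> {0..k}" "p \<in> {..l}" for i p
  proof (cases "coeff (g $$ i) p = 0 \<or> coeff (F $$ (k - i)) (l - p) = 0")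
    case True
    then show ?thesis by (auto simp: coeff_graded_part assms(2))
  next
    case False
    then have "grade l k = a + grade (l - p) (k - i)"
      using that by (intro grade_of_product_term[OF assms]) auto
    then show ?thesis by (simp add: coeff_graded_part assms(2))
  qed
  have "coeff ((g * F) $$ k) l = (\<Sum>i=0..k. \<Sum>p\<le>l.
     (if a \<le> grade l k then coeff (g $$ i) p * coeff (graded_part (grade l k - a) F $$ (k - i)) (l - p) else 0))"
    unfolding coeff_mult_fps by (intro sum.cong refl summand)
  also have "\<dots> = (if a \<le> grade l k then coeff ((g * graded_part (grade l k - a) F) $$ k) l else 0)"
    unfolding coeff_mult_fps by simp
  finally show ?thesis .
qed

text \<open>
  The action of a pair \<open>(S, T)\<close> on the Lie algebra, on the level of series.
\<close>

definition radial_act :: "'a::field_char_0 poly fps \<Rightarrow> 'a poly fps \<Rightarrow> 'a poly fps \<Rightarrow> 'a poly fps" where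
  "radial_act g t F = radial_bracket g F + t * F"

lemma act_radial: "g \<in> max_ideal \<Longrightarrow> t \<in> max_ideal \<Longrightarrow> F \<in> max_ideal \<Longrightarrow> act (radial g, to_ps t) (radial F) = radial (radial_act g t F)"
  by (simp add: act_def radial_act_def lie_radial_eq_bracket to_ps_scale_radial max_ideal_degree_bounded radial_add)

lemma radial_act_max_ideal: "g \<in> max_ideal \<Longrightarrow> t \<in> max_ideal \<Longrightarrow> F \<in> max_ideal \<Longrightarrow> radial_act g t F \<in> max_ideal"
  unfolding radial_act_def by (intro max_ideal_add radial_bracket_max_ideal max_ideal_mult max_ideal_degree_bounded)

lemma homogeneous_radial_act:
  assumes "homogeneous i g" "homogeneous i t" "homogeneous j F"
  shows "homogeneous (i + j) (radial_act g t F)"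
proof -
  have "homogeneous (i + j) (F * fps_XD g)"
    using homogeneous_mult[OF assms(3) homogeneous_XD[OF assms(1)]] by (simp add: add.commute)
  then show ?thesis
    unfolding radial_act_def radial_bracket_def
    using homogeneous_mult[OF assms(1) homogeneous_XD[OF assms(3)]] homogeneous_mult[OF assms(2,3)]
    by (simp add: homogeneous_add homogeneous_diff)
qed

lemma coeff_radial_act:
  assumes "homogeneous a g" "homogeneous a t" "degree_bounded F"
  shows "coeff (radial_act g t F $$ k) l =
    (if a \<le> grade l k then coeff (radial_act g t (graded_part (grade l k - a) F) $$ k) l else 0)"
proof -
  have "radial_act g t F = g * fps_XD F - fps_XD g * F + t * F" for F
    by (simp add: radial_act_def radial_bracket_def mult.commute)
  then show ?thesis
    using coeff_homogeneous_mult[OF assms(1) degree_bounded_XD[OF assms(3)], of k l]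
      coeff_homogeneous_mult[OF homogeneous_XD[OF assms(1)] assms(3), of k l] coeff_homogeneous_mult[OF assms(2,3), of k l]
    by (simp add: graded_part_XD assms(3))
qed

section \<open>The images of the level maps\<close>

lemma d_map_map_upt: "d_map u (map y [0..<k]) = (\<Sum>i<k. act (y i) (hpart u i))"
  by (simp add: d_map_def)

text \<open>
  Unrolled, the recursive definition of the domain requires that the level map vanishes on each
  list obtained by dropping the first \<open>j \<ge> 1\<close> entries. Families indexed by natural numbers are
  easier to add and to scale than lists.
\<close>

lemma d_dom_eq:
  "d_dom u n k = {map y [0..<k] | y. (\<forall>i<k. y i \<in> A_hom (n - i)) \<and>
     (\<forall>j\<in>{1..k}. (\<Sum>i<k - j. act (y (j + i)) (hpart u i)) = 0)}" (is "_ = ?D n k")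
proof (induction k arbitrary: n)
  case (Suc k)
  show ?case
  proof (intro equalityI subsetI)
    fix Zs assume "Zs \<in> d_dom u n (Suc k)"
    then obtain Y y where Zs: "Zs = Y # map y [0..<k]" and Y: "Y \<in> A_hom n"
      and y: "\<forall>i<k. y i \<in> A_hom (n - 1 - i)" "\<forall>j\<in>{1..k}. (\<Sum>i<k - j. act (y (j + i)) (hpart u i)) = 0"
      and z: "d_map u (map y [0..<k]) = 0"
      unfolding d_dom.simps Suc by blast
    define y' where "y' = case_nat Y y"
    have "Zs = map y' [0..<Suc k]"
      unfolding Zs y'_def by (simp add: map_upt_Suc del: upt_Suc)
    moreover have "\<forall>i<Suc k. y' i \<in> A_hom (n - i)"
      using Y y(1) by (auto simp: y'_def split: nat.split)
    moreover have "\<forall>j\<in>{1..Suc k}. (\<Sum>i<Suc k - j. act (y' (j + i)) (hpart u i)) = 0"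
    proof
      fix j assume "j \<in> {1..Suc k}"
      then obtain j' where j': "j = Suc j'" "j' \<le> k" by (cases j) auto
      show "(\<Sum>i<Suc k - j. act (y' (j + i)) (hpart u i)) = 0"
        using y(2) z j' by (cases "j' = 0") (auto simp: y'_def d_map_map_upt)
    qed
    ultimately show "Zs \<in> ?D n (Suc k)" by blast
  next
    fix Zs assume "Zs \<in> ?D n (Suc k)"
    then obtain y where Zs: "Zs = map y [0..<Suc k]" and y: "\<forall>i<Suc k. y i \<in> A_hom (n - i)"
      and z: "\<forall>j\<in>{1..Suc k}. (\<Sum>i<Suc k - j. act (y (j + i)) (hpart u i)) = 0" by blast
    define y' where "y' i = y (Suc i)" for i
    have "Zs = y 0 # map y' [0..<k]"
      unfolding Zs y'_def by (simp add: map_upt_Suc del: upt_Suc)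
    moreover have "map y' [0..<k] \<in> ?D (n - 1) k"
    proof -
      have "\<forall>i<k. y' i \<in> A_hom (n - 1 - i)" using y by (auto simp: y'_def)
      moreover have "\<forall>j\<in>{1..k}. (\<Sum>i<k - j. act (y' (j + i)) (hpart u i)) = 0"
      proof
        fix j assume "j \<in> {1..k}"
        then show "(\<Sum>i<k - j. act (y' (j + i)) (hpart u i)) = 0"
          using bspec[OF z, of "Suc j"] by (simp add: y'_def)
      qed
      ultimately show ?thesis by blast
    qed
    moreover have "d_map u (map y' [0..<k]) = 0"
      using bspec[OF z, of 1] by (simp add: y'_def d_map_map_upt)
    moreover have "y 0 \<in> A_hom n" using y by force
    ultimately show "Zs \<in> d_dom u n (Suc k)"
      unfolding d_dom.simps Suc by blast
  qed
qed auto

lemma d_image_eq: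
  "d_image u n k = {\<Sum>i<k. act (y i) (hpart u i) | y. (\<forall>i<k. y i \<in> A_hom (n - i)) \<and>
     (\<forall>j\<in>{1..k}. (\<Sum>i<k - j. act (y (j + i)) (hpart u i)) = 0)}"
  unfolding d_image_def d_dom_eq by (simp only: setcompr_eq_image image_image d_map_map_upt)


lemma vf_apply_const_mult: "vf_apply X (ps_const c * f) = ps_const c * vf_apply X f"
  by (simp add: vf_apply_def d_const_mult distrib_left mult.left_commute)

lemma act_add: "act (Y + Z) u = act Y u + act Z u"
  by (simp add: act_def lie_add_left vec_eq_iff algebra_simps)

definition scale_pair :: "'a::field_char_0 \<Rightarrow> 'a vf \<times> 'a ps \<Rightarrow> 'a vf \<times> 'a ps" where
  "scale_pair c Y = (vf_scale c (fst Y), ps_const c * snd Y)"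

lemma act_scale_pair: "act (scale_pair c Y) u = vf_scale c (act Y u)"
  by (simp add: act_def scale_pair_def vf_scale_def lie_def vf_apply_scale vf_apply_const_mult
      vec_eq_iff algebra_simps)

lemma subspace_E_hom: "vf.subspace (E_hom n :: 'a::field_char_0 vf set)"
  unfolding vf.subspace_def hom_image_eq
proof (intro conjI ballI allI)
  show "0 \<in> radial ` {F \<in> max_ideal. homogeneous n F}"
    by (rule image_eqI[of _ _ 0]) (simp_all add: max_ideal_def homogeneous_zero)
  fix x y :: "'a vf" assume "x \<in> radial ` {F \<in> max_ideal. homogeneous n F}" "y \<in> radial ` {F \<in> max_ideal. homogeneous n F}"
  then obtain F G where "F \<in> max_ideal" "homogeneous n F" "x = radial F" "G \<in> max_ideal" "homogeneous n G" "y = radial G" by blast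
  then show "x + y \<in> radial ` {F \<in> max_ideal. homogeneous n F}"
    by (intro image_eqI[of _ _ "F + G"]) (simp_all add: radial_add max_ideal_add homogeneous_add)
next
  fix c and x :: "'a vf" assume "x \<in> radial ` {F \<in> max_ideal. homogeneous n F}"
  then obtain F where "F \<in> max_ideal" "homogeneous n F" "x = radial F" by blast
  then show "vf_scale c x \<in> radial ` {F \<in> max_ideal. homogeneous n F}"
    by (intro image_eqI[of _ _ "fps_const [:c:] * F"])
      (simp_all add: vf_scale_radial homogeneous_const_mult max_ideal_mult[OF degree_bounded_const])
qed

lemma A_hom_obtain:
  assumes "Y \<in> A_hom n"
  obtains g t where "g \<in> max_ideal" "t \<in> max_ideal" "homogeneous n g" "homogeneous n t" "Y = (radial g, to_ps t)"
  using assms unfolding A_hom_def hom_image_eq by blast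

lemma A_hom_intro: "g \<in> max_ideal \<Longrightarrow> t \<in> max_ideal \<Longrightarrow> homogeneous n g \<Longrightarrow> homogeneous n t \<Longrightarrow> (radial g, to_ps t) \<in> A_hom n"
  unfolding A_hom_def hom_image_eq by blast

lemma A_hom_add: "Y \<in> A_hom n \<Longrightarrow> Z \<in> A_hom n \<Longrightarrow> Y + Z \<in> A_hom n"
  by (elim A_hom_obtain) (auto simp flip: radial_add to_ps_add intro!: A_hom_intro max_ideal_add homogeneous_add)

lemma A_hom_scale: "Y \<in> A_hom n \<Longrightarrow> scale_pair c Y \<in> A_hom n"
  by (elim A_hom_obtain)
    (auto simp: scale_pair_def vf_scale_radial simp flip: to_ps_const_mult
       intro!: A_hom_intro homogeneous_const_mult max_ideal_mult[OF degree_bounded_const])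

lemma A_hom_zero: "0 \<in> A_hom n"
  using A_hom_intro[of 0 0 n] by (simp add: max_ideal_def homogeneous_zero zero_prod_def)

lemma act_zero: "act 0 u = 0"
  using act_add[of 0 0 u] by simp

lemma subspace_d_image: "vf.subspace (d_image u n k)"
  unfolding vf.subspace_def
proof (intro conjI ballI allI)
  let ?ker = "\<lambda>y. (\<forall>i<k. y i \<in> A_hom (n - i)) \<and> (\<forall>j\<in>{1..k}. (\<Sum>i<k - j. act (y (j + i)) (hpart u i)) = 0)"
  let ?d = "\<lambda>y. \<Sum>i<k. act (y i) (hpart u i)"
  have intro: "x \<in> d_image u n k" if "?ker y" "x = ?d y" for x y
    using that unfolding d_image_eq by blast
  show "0 \<in> d_image u n k"
    by (rule intro[of "\<lambda>_. 0"]) (simp_all add: A_hom_zero act_zero)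
  fix x z assume "x \<in> d_image u n k" "z \<in> d_image u n k"
  then obtain y y' where "?ker y" "x = ?d y" "?ker y'" "z = ?d y'" unfolding d_image_eq by blast
  then show "x + z \<in> d_image u n k"
    by (intro intro[of "\<lambda>i. y i + y' i"]) (simp_all add: act_add sum.distrib A_hom_add)
next
  let ?ker = "\<lambda>y. (\<forall>i<k. y i \<in> A_hom (n - i)) \<and> (\<forall>j\<in>{1..k}. (\<Sum>i<k - j. act (y (j + i)) (hpart u i)) = 0)"
  let ?d = "\<lambda>y. \<Sum>i<k. act (y i) (hpart u i)"
  have intro: "x \<in> d_image u n k" if "?ker y" "x = ?d y" for x y
    using that unfolding d_image_eq by blast
  fix c x assume "x \<in> d_image u n k"
  then obtain y where "?ker y" "x = ?d y" unfolding d_image_eq by blast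
  then show "vf_scale c x \<in> d_image u n k"
    by (intro intro[of "\<lambda>i. scale_pair c (y i)"])
      (simp_all add: act_scale_pair A_hom_scale vf.scale_sum_right[symmetric])
qed

lemma d_image_subset:
  assumes F: "F \<in> max_ideal" and k: "k \<le> n"
  shows "d_image (radial F) n k \<subseteq> E_hom n"
proof
  fix x assume "x \<in> d_image (radial F) n k"
  then obtain y where y: "\<forall>i<k. y i \<in> A_hom (n - i)" and x: "x = (\<Sum>i<k. act (y i) (hpart (radial F) i))"
    unfolding d_image_eq by blast
  have "act (y i) (hpart (radial F) i) \<in> E_hom n" if "i \<in> {..<k}" for i
  proof -
    have "y i \<in> A_hom (n - i)" using y that by blast
    then obtain g t where gt: "g \<in> max_ideal" "t \<in> max_ideal" "homogeneous (n - i) g" "homogeneous (n - i) t" "y i = (radial g, to_ps t)"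
      by (rule A_hom_obtain)
    have "homogeneous n (radial_act g t (graded_part i F))"
      using homogeneous_radial_act[OF gt(3,4) homogeneous_graded_part[OF max_ideal_degree_bounded[OF F], of i]] that k by simp
    then show ?thesis
      unfolding hom_image_eq gt(5) hpart_radial[OF F] act_radial[OF gt(1,2) graded_part_max_ideal[OF F]]
      using radial_act_max_ideal[OF gt(1,2) graded_part_max_ideal[OF F]] by blast
  qed
  then show "x \<in> E_hom n"
    unfolding x by (intro vf.subspace_sum subspace_E_hom)
qed

text \<open>
  Sum up all entries of the list to a single pair. The homogeneous parts of its action on F of
  grade below n are the expressions that vanish by the kernel conditions, and the part of grade
  n is the value of the level map.
\<close>

lemma d_image_leading_part:
  assumes F: "F \<in> max_ideal" and P: "P \<in> max_ideal" and mem: "radial P \<in> d_image (radial F) n n"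
  obtains g t where "g \<in> max_ideal" "t \<in> max_ideal"
    "\<And>k l. l \<le> k \<Longrightarrow> grade l k < n \<Longrightarrow> coeff (radial_act g t F $$ k) l = 0"
    "\<And>k l. l \<le> k \<Longrightarrow> grade l k = n \<Longrightarrow> coeff (radial_act g t F $$ k) l = coeff (P $$ k) l"
proof -
  obtain y where y: "\<forall>i<n. y i \<in> A_hom (n - i)"
    and ker: "\<forall>j\<in>{1..n}. (\<Sum>i<n - j. act (y (j + i)) (hpart (radial F) i)) = 0"
    and Py: "radial P = (\<Sum>i<n. act (y i) (hpart (radial F) i))"
    using mem unfolding d_image_eq by blast
  define R where "R i p \<longleftrightarrow> fst p \<in> max_ideal \<and> snd p \<in> max_ideal \<and> homogeneous (n - i) (fst p) \<and> homogeneous (n - i) (snd p) \<and>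
      y i = (radial (fst p), to_ps (snd p))" for i and p :: "'a poly fps \<times> 'a poly fps"
  have "\<exists>p. i < n \<longrightarrow> R i p" for i
  proof (cases "i < n")
    case True
    then have "y i \<in> A_hom (n - i)" using y by blast
    then obtain g t where "g \<in> max_ideal" "t \<in> max_ideal" "homogeneous (n - i) g" "homogeneous (n - i) t" "y i = (radial g, to_ps t)"
      by (rule A_hom_obtain)
    then have "R i (g, t)" by (simp add: R_def)
    then show ?thesis by blast
  qed simp
  then have "\<exists>p. \<forall>i. i < n \<longrightarrow> R i (p i)" by (intro choice allI)
  then obtain p where p: "\<And>i. i < n \<Longrightarrow> R i (p i)" by blast
  define A where "A i = radial_act (fst (p i)) (snd (p i))" for i
  have act_y: "act (y i) (hpart (radial F) j) = radial (A i (graded_part j F))" if "i < n" for i j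
    using p[OF that] by (simp add: R_def A_def hpart_radial F act_radial graded_part_max_ideal)
  have A_max_ideal: "A i G \<in> max_ideal" if "i < n" "G \<in> max_ideal" for i G
    using p[OF that(1)] that(2) by (simp add: R_def A_def radial_act_max_ideal)
  have sum_max_ideal: "(\<Sum>i\<in>I. H i) \<in> max_ideal" if "\<And>i. i \<in> I \<Longrightarrow> H i \<in> max_ideal" for I :: "nat set" and H :: "nat \<Rightarrow> 'a poly fps"
    using that by (induction I rule: infinite_finite_induct) (auto intro: max_ideal_add, auto simp: max_ideal_def)
  have coeff_A: "coeff (A i F $$ k) l = (if n - i \<le> grade l k then coeff (A i (graded_part (grade l k - (n - i)) F) $$ k) l else 0)"
    if "i < n" for i k l
    using p[OF that] coeff_radial_act[of "n - i" "fst (p i)" "snd (p i)" F k l] F by (simp add: R_def A_def max_ideal_degree_bounded)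
  define g where "g = (\<Sum>i<n. fst (p i))"
  define t where "t = (\<Sum>i<n. snd (p i))"
  have gt: "g \<in> max_ideal" "t \<in> max_ideal"
    unfolding g_def t_def using p by (auto intro!: sum_max_ideal simp: R_def)
  have total: "radial_act g t F = (\<Sum>i<n. A i F)"
  proof -
    have "radial_act (\<Sum>i\<in>I. fst (p i)) (\<Sum>i\<in>I. snd (p i)) F = (\<Sum>i\<in>I. A i F)" if "finite I" for I
      using that
    proof (induction I rule: finite_induct)
      case (insert x I)
      have "radial_act (a + b) (c + d) F = radial_act a c F + radial_act b d F" for a b c d
        by (simp add: radial_act_def radial_bracket_def algebra_simps)
      then show ?case using insert by (simp add: A_def)
    qed (simp add: radial_act_def radial_bracket_def fps_XD_def)
    then show ?thesis by (simp add: g_def t_def)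
  qed
    \<comment> \<open>entry i of the list, of grade \<open>n - i\<close>, meets the part of F of grade \<open>i - (n - m)\<close>\<close>
  have low: "coeff (radial_act g t F $$ k) l = 0" if "grade l k < n" for k l
  proof -
    define m where "m = grade l k"
    have m: "m < n" using that by (simp add: m_def)
    have "radial (\<Sum>i<m. A (n - m + i) (graded_part i F)) = (\<Sum>i<n - (n - m). act (y (n - m + i)) (hpart (radial F) i))"
      using m by (simp add: radial_sum act_y)
    also have "\<dots> = 0" by (rule bspec[OF ker]) (use m in simp)
    also have "\<dots> = radial 0" by simp
    finally have zero: "(\<Sum>i<m. A (n - m + i) (graded_part i F)) = 0"
      using m by (intro radial_inject[OF _ degree_bounded_zero] max_ideal_degree_bounded sum_max_ideal A_max_ideal graded_part_max_ideal F) auto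
    have "coeff (radial_act g t F $$ k) l = (\<Sum>i<n. if n - m \<le> i then coeff (A i (graded_part (i - (n - m)) F) $$ k) l else 0)"
      unfolding total fps_sum_nth coeff_sum
    proof (rule sum.cong[OF refl])
      fix i assume "i \<in> {..<n}"
      then have "i < n" by simp
      then show "coeff (A i F $$ k) l = (if n - m \<le> i then coeff (A i (graded_part (i - (n - m)) F) $$ k) l else 0)"
      proof (cases "n - m \<le> i")
        case True
        then have "n - i \<le> grade l k" "grade l k - (n - i) = i - (n - m)" using \<open>i < n\<close> m by (auto simp: m_def)
        then show ?thesis using True by (simp add: coeff_A[OF \<open>i < n\<close>])
      next
        case False
        then have "\<not> n - i \<le> grade l k" using \<open>i < n\<close> m by (simp add: m_def)
        then show ?thesis using False by (simp add: coeff_A[OF \<open>i < n\<close>])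
      qed
    qed
    also have "\<dots> = (\<Sum>i\<in>{n - m..<n}. coeff (A i (graded_part (i - (n - m)) F) $$ k) l)"
      by (rule sum.mono_neutral_cong_right) auto
    also have "\<dots> = (\<Sum>i<m. coeff (A (n - m + i) (graded_part i F) $$ k) l)"
      using m by (intro sum.reindex_bij_witness[of _ "\<lambda>i. n - m + i" "\<lambda>i. i - (n - m)"]) auto
    also have "\<dots> = coeff ((\<Sum>i<m. A (n - m + i) (graded_part i F)) $$ k) l"
      by (simp add: fps_sum_nth coeff_sum)
    finally show ?thesis by (simp add: zero)
  qed
  have top: "coeff (radial_act g t F $$ k) l = coeff (P $$ k) l" if "grade l k = n" for k l
  proof -
    have "radial P = radial (\<Sum>i<n. A i (graded_part i F))" using Py by (simp add: radial_sum act_y)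
    then have P': "P = (\<Sum>i<n. A i (graded_part i F))"
      by (intro radial_inject max_ideal_degree_bounded sum_max_ideal A_max_ideal graded_part_max_ideal F P) auto
    have "coeff (radial_act g t F $$ k) l = (\<Sum>i<n. coeff (A i (graded_part i F) $$ k) l)"
      unfolding total fps_sum_nth coeff_sum using that by (intro sum.cong refl) (simp add: coeff_A)
    then show ?thesis by (simp add: P' fps_sum_nth coeff_sum)
  qed
  show ?thesis by (rule that[OF gt low top])
qed

text \<open>
  Up to \<open>\<rho>\<^sup>r\<close>, the action of any pair on the normal form has coefficients divisible by \<open>s + b\<close>,
  and no term in \<open>\<rho>\<close>. The homogeneous parts of the normal form are \<open>s \<rho>\<close>, \<open>b \<rho>\<close> and \<open>c \<rho>\<^sup>r\<close>, of
  grades 1, 2 and \<open>2 r\<close>. The first two involve \<open>\<rho>\<close> only to the first power. If the third were a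
  leading part, the vanishing of all lower grades would make the whole coefficient of \<open>\<rho>\<^sup>r\<close>
  equal to the constant c, which is divisible by \<open>s + b\<close> only for \<open>c = 0\<close>.
\<close>

lemma nf_series_not_in_image:
  fixes b c :: "'a::field_char_0"
  assumes r: "r \<ge> 2" and n: "n \<ge> 1" and mem: "hpart (radial (nf_series r b c)) n \<in> d_image (radial (nf_series r b c)) n n"
  shows "hpart (radial (nf_series r b c)) n = 0"
proof -
  let ?F = "nf_series r b c"
  have F: "?F \<in> max_ideal" using r by (intro nf_series_max_ideal) simp
  obtain g t where gt: "g \<in> max_ideal" "t \<in> max_ideal"
    and low: "\<And>k l. l \<le> k \<Longrightarrow> grade l k < n \<Longrightarrow> coeff (radial_act g t ?F $$ k) l = 0"
    and top: "\<And>k l. l \<le> k \<Longrightarrow> grade l k = n \<Longrightarrow> coeff (radial_act g t ?F $$ k) l = coeff (graded_part n ?F $$ k) l"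
    using d_image_leading_part[OF F graded_part_max_ideal[OF F] mem[unfolded hpart_radial[OF F]]] by blast
  define q where "q = g - fps_XD g + t"
  have q: "q \<in> max_ideal" unfolding q_def by (intro max_ideal_add max_ideal_diff max_ideal_XD gt)
  have radial_act: "radial_act g t ?F = q * ?F + fps_const [:(of_nat r - 1) * c:] * (fps_X ^ r * g)"
    unfolding radial_act_def act_nf_series[OF r] q_def by (simp add: algebra_simps)
  have H: "radial_act g t ?F $$ Suc k = [:b, 1:] * q $$ k" if "Suc k \<le> r" for k
  proof -
    have "(if r \<le> Suc k then smult c (q $$ (Suc k - r)) else 0) = 0"
      using that q by (simp add: max_ideal_def)
    moreover have "(fps_const [:(of_nat r - 1) * c:] * (fps_X ^ r * g)) $$ Suc k = 0"
      using that gt(1) by (simp add: fps_X_power_mult_nth max_ideal_def)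
    ultimately show ?thesis unfolding radial_act fps_add_nth mult_nf_series_nth[OF r] by simp
  qed
  have "coeff (?F $$ k) l = 0" if "grade l k = n" "l \<le> k" for k l
  proof (rule ccontr)
    assume nz: "coeff (?F $$ k) l \<noteq> 0"
    have eq: "coeff (radial_act g t ?F $$ k) l = coeff (?F $$ k) l"
      using top[OF that(2,1)] that(1) by (simp add: coeff_graded_part max_ideal_degree_bounded[OF F])
    have "k = 1 \<or> k = r" using nz r by (auto simp: nf_series_nth split: if_splits)
    then show False
    proof
      assume "k = 1"
      then have "radial_act g t ?F $$ k = 0" using H[of 0] r q by (simp add: max_ideal_def)
      then show False using eq nz by simp
    next
      assume k: "k = r"
      then have l: "l = 0" and c: "c \<noteq> 0" and Fk: "?F $$ k = [:c:]"
        using nz r by (auto simp: nf_series_nth coeff_pCons split: if_splits nat.splits)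
      have "radial_act g t ?F $$ r = [:c:]"
      proof (rule poly_eqI)
        fix j
        consider "j = 0" | "0 < j" "j \<le> r" | "j > r" by linarith
        then show "coeff (radial_act g t ?F $$ r) j = coeff [:c:] j"
        proof cases
          case 1 then show ?thesis using eq Fk by (simp add: k l)
        next
          case 2
          then have "grade j r < n" using that(1) by (simp add: grade_def k l)
          then show ?thesis using low[of j r] 2 by (simp add: coeff_pCons split: nat.splits)
        next
          case 3
          then have "coeff (radial_act g t ?F $$ r) j = 0"
            using radial_act_max_ideal[OF gt F] degree_bounded_coeff max_ideal_degree_bounded not_le by blast
          then show ?thesis using 3 by (simp add: coeff_pCons split: nat.splits)
        qed
      qed
      moreover have "radial_act g t ?F $$ r = [:b, 1:] * q $$ (r - 1)"
        using H[of "r - 1"] r by simp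
      ultimately have "[:c:] = [:b, 1:] * q $$ (r - 1)" by simp
      \<comment> \<open>a nonzero constant is no multiple of \<open>s + b\<close>\<close>
      from arg_cong[OF this, of "\<lambda>p. poly p (- b)"] show False using c by simp
    qed
  qed
  moreover have "coeff (?F $$ k) l = 0" if "\<not> l \<le> k" for k l
    using max_ideal_degree_bounded[OF F] that unfolding degree_bounded_coeff by blast
  ultimately have "coeff (graded_part n ?F $$ k) l = 0" for k l
    unfolding coeff_graded_part[OF max_ideal_degree_bounded[OF F]] by metis
  then have "graded_part n ?F = 0"
    by (intro fps_ext poly_eqI) simp
  then show ?thesis by (simp add: hpart_radial F)
qed

text \<open>
  Only the complements at the final levels \<open>k = n\<close> have to contain a prescribed vector; at the
  other levels the vector 0 serves as the prescribed one.
\<close>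

lemma simplest_orbital_nf_nf_series:
  assumes r: "r \<ge> 2"
  shows "simplest_orbital_nf (orbital_nf r b c)"
proof -
  let ?F = "nf_series r b c"
  have F: "?F \<in> max_ideal" using r by (intro nf_series_max_ideal) simp
  have v: "orbital_nf r b c = Theta + radial ?F" using r by (intro orbital_nf_eq) simp
  define Q where "Q n k C \<longleftrightarrow> 1 \<le> k \<and> k \<le> n \<longrightarrow> complement_in (E_hom n) (d_image (radial ?F) n k) C \<and>
      (k = n \<longrightarrow> hpart (radial ?F) n \<in> C)" for n k and C :: "'a vf set"
  have "\<exists>C. Q n k C" for n k
  proof (cases "1 \<le> k \<and> k \<le> n")
    case True
    define p where "p = (if k = n then hpart (radial ?F) n else 0)"
    have "hpart (radial ?F) n \<in> E_hom n"
      unfolding hpart_radial[OF F] hom_image_eq using graded_part_max_ideal[OF F] homogeneous_graded_part[OF max_ideal_degree_bounded[OF F]] by blast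
    then have "p \<in> E_hom n"
      using vf.subspace_0[OF subspace_E_hom[of n]] by (auto simp: p_def)
    moreover have "p = 0" if "p \<in> d_image (radial ?F) n k"
      using nf_series_not_in_image[OF r, of n b c] that True by (auto simp: p_def split: if_splits)
    moreover have "d_image (radial ?F) n k \<subseteq> E_hom n"
      using d_image_subset[OF F] True by blast
    ultimately obtain C where "complement_in (E_hom n) (d_image (radial ?F) n k) C" "p \<in> C"
      using complement_through[OF subspace_E_hom subspace_d_image] by blast
    then have "Q n k C" by (auto simp: Q_def p_def)
    then show ?thesis ..
  qed (auto simp: Q_def)
  then have "\<exists>C. \<forall>n k. Q n k (C n k)" by (intro choice allI)
  then obtain C where "\<And>n k. Q n k (C n k)" by blast
  then have C: "Q n k (C n k)" for n k .
  show ?thesis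
    unfolding simplest_orbital_nf_def Let_def v remove_rotation_Theta_add[OF F]
  proof (intro conjI exI[of _ C] allI impI)
    show "Theta + radial ?F \<in> Theta_E" by (rule Theta_radial_in_Theta_E[OF F])
    fix n k :: nat assume "1 \<le> k \<and> k \<le> n"
    then show "complement_in (E_hom n) (d_image (radial ?F) n k) (C n k)" using C[of n k] by (simp add: Q_def)
  next
    fix n :: nat assume "1 \<le> n"
    then show "hpart (radial ?F) n \<in> C n n" using C[of n n] by (simp add: Q_def)
  qed
qed

section \<open>Transformation, normal form and symmetries combined\<close>

lemma transformable_to_nf_series:
  assumes \<beta>: "\<beta> \<in> E_coeffs" and nz: "\<beta> 1 1 \<noteq> 0"
  obtains r b c where "r \<ge> 2" "transformable (Theta + E_series \<beta>) (orbital_nf r b c)"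
proof -
  define F where "F = gen_fps \<beta>"
  define G where "G = fps_const [:1 / \<beta> 1 1:] * F"
  have F: "F \<in> max_ideal" unfolding F_def by (rule gen_fps_in_max_ideal[OF \<beta>])
  have G: "G \<in> max_ideal" unfolding G_def by (rule max_ideal_mult[OF degree_bounded_const F])
  have coeff_G: "coeff (G $$ k) l = \<beta> l k / \<beta> 1 1" for k l
    using E_coeffs_supp[OF \<beta>] by (simp add: G_def F_def coeff_gen_fps)
  have "G $$ Suc 0 = [:\<beta> 0 1 / \<beta> 1 1, 1:]"
  proof (rule poly_eqI)
    fix l
    show "coeff (G $$ Suc 0) l = coeff [:\<beta> 0 1 / \<beta> 1 1, 1:] l"
      using E_coeffs_supp[OF \<beta>, of l 1] nz unfolding coeff_G
      by (cases l; cases "l - 1") (auto simp: coeff_pCons split: nat.splits)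
  qed
  then obtain r c where r: "r \<ge> 2" and eq: "orbit_equiv G (nf_series r (\<beta> 0 1 / \<beta> 1 1) c)"
    using orbit_equiv_nf_series[OF G] by blast
  then obtain g where g: "g \<in> permissible" "g (radial G) = radial (nf_series r (\<beta> 0 1 / \<beta> 1 1) c)"
    unfolding orbit_equiv_def by blast
  have N: "nf_series r (\<beta> 0 1 / \<beta> 1 1) c \<in> max_ideal" using r by (intro nf_series_max_ideal) simp
  have "remove_rotation (Theta + E_series \<beta>) = radial F"
    unfolding E_series_gen_fps[OF \<beta>] F_def[symmetric] by (rule remove_rotation_Theta_add[OF F])
  then have "vf_scale (1 / \<beta> 1 1) (remove_rotation (Theta + E_series \<beta>)) = radial G"
    by (simp only: vf_scale_radial G_def)
  then have "orbital_nf r (\<beta> 0 1 / \<beta> 1 1) c =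
      restore_rotation (g (vf_scale (1 / \<beta> 1 1) (remove_rotation (Theta + E_series \<beta>))))"
    using r by (simp only: g(2) restore_rotation_radial[OF N]) (simp add: orbital_nf_eq)
  then have "transformable (Theta + E_series \<beta>) (orbital_nf r (\<beta> 0 1 / \<beta> 1 1) c)"
    unfolding transformable_def using g(1) nz by (intro exI[of _ "1 / \<beta> 1 1"] exI[of _ g]) simp
  with r show ?thesis by (rule that)
qed

lemma state_symmetries_trivial:
  assumes r: "r \<ge> 2" and c: "c \<noteq> 0"
    and S: "(S, 0) \<in> symmetry_generators (orbital_nf r b c)"
  shows "trivial_state_symmetry (orbital_nf r b c) S"
proof -
  have N: "nf_series r b c \<in> max_ideal" using r by (intro nf_series_max_ideal) simp
  have u: "remove_rotation (orbital_nf r b c) = radial (nf_series r b c)"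
    using r by (simp add: orbital_nf_eq remove_rotation_Theta_add N)
  obtain g where g: "g \<in> max_ideal" "S = radial g"
    using S unfolding symmetry_generators_def A_space_def E_alg_eq by blast
  have "radial (radial_bracket g (nf_series r b c)) = radial 0"
    using S unfolding symmetry_generators_def u by (simp add: act_def g lie_radial_eq_bracket N)
  then have "radial_bracket g (nf_series r b c) = 0"
    by (rule radial_inject[rotated 2]) (simp_all add: max_ideal_degree_bounded radial_bracket_max_ideal g N)
  then obtain a where "g = fps_const [:a:] * nf_series r b c"
    using commuting_with_nf_series[OF g(1) r c] by blast
  then show ?thesis
    unfolding trivial_state_symmetry_def u by (auto simp: g(2) vf_scale_radial)
qed

theorem theorem4p1:
  fixes \<beta> :: "nat \<Rightarrow> nat \<Rightarrow> 'a::field_char_0" and v :: "'a vf"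
  assumes "\<beta> \<in> E_coeffs"
    and "v = Theta + E_series \<beta>"
    and "\<beta> 1 1 \<noteq> 0"
  shows "(\<exists>r\<ge>2. \<exists>b1 br. transformable v (orbital_nf r b1 br) \<and>
            simplest_orbital_nf (orbital_nf r b1 br)) \<and>
         (\<forall>r\<ge>2. \<forall>b1 br. transformable v (orbital_nf r b1 br) \<and>
            simplest_orbital_nf (orbital_nf r b1 br) \<longrightarrow>
              \<not> finitely_generated_group (symmetry_group (orbital_nf r b1 br)) \<and>
              (br \<noteq> 0 \<longrightarrow>
                 (\<forall>S. (S, 0) \<in> symmetry_generators (orbital_nf r b1 br) \<longrightarrow>
                    trivial_state_symmetry (orbital_nf r b1 br) S)))"
proof (intro conjI allI impI)
  obtain r b c where "r \<ge> 2" "transformable v (orbital_nf r b c)"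
    using transformable_to_nf_series[OF assms(1,3)] unfolding assms(2) by blast
  then show "\<exists>r\<ge>2. \<exists>b1 radial_bracket. transformable v (orbital_nf r b1 radial_bracket) \<and>
            simplest_orbital_nf (orbital_nf r b1 radial_bracket)"
    using simplest_orbital_nf_nf_series by blast
next
  fix r :: nat and b c :: 'a
  assume r: "r \<ge> 2"
  have "nf_series r b c \<in> max_ideal" "nf_series r b c $$ 1 \<noteq> 0"
    using r by (simp_all add: nf_series_max_ideal nf_series_nth)
  then show "\<not> finitely_generated_group (symmetry_group (orbital_nf r b c))"
    using symmetry_group_not_finitely_generated[of "nf_series r b c"] r by (simp add: orbital_nf_eq)
qed (rule state_symmetries_trivial)

end
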